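(* Let $f:\subseteq\mathbb{R}^n\to\mathbb{R}^m$ be computable, open, and semi-algebraic over $\mathbb{R}_c$, with open domain $X:=\operatorname{dom}(f)$. Then $X$ is r.e. open and $f$ is effectively open.
   Context: $\mathbb{R}_c$ denotes the field of computable real numbers. For a subfield $F\subseteq\mathbb{R}$, a set $S\subseteq\mathbb{R}^n$ is basic semi-algebraic over $F$ if $S=\{\vec x:p_1(\vec x)\ge0,\dots,p_k(\vec x)\ge0,q_1(\vec x)>0,\dots,q_\ell(\vec x)>0\}$ for some polynomials $p_i,q_j\in F[X_1,\dots,X_n]$; semi-algebraic over $F$ if a finite union of intersections of such sets; a partial function $f:\subseteq\mathbb{R}^n\to\mathbb{R}^m$ is semi-algebraic over $F$ if its graph $\{(\vec x,f(\vec x)):\vec x\in\operatorname{dom}f\}\subseteq\mathbb{R}^{n+m}$ is. Computability in the Type-2 sense (Weihrauch), with Cauchy representation for $\mathbb{R}^n$ and $\theta^d_<$ for open sets (a name lists rational centers and radii of open balls with union the set); r.e. open means having a computable $\theta^n_<$-name. $f$ open and effectively open means $U\mapsto f[U]$, for open $U\subseteq X$, is $(\theta^n_<\to\theta^m_<)$-computable. *)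

theory Defs
  imports Complex_Main "HOL-Library.Nat_Bijection"
begin

text \<open>Codes of relative partial recursive functions (Kleene schemes plus one query to the input).
  A Type-2 machine with input p : nat => nat (an element of Baire space) computing
  an output q : nat => nat is modelled by a code e such that, for every k,
  e evaluated on argument [k] with input p yields q k.\<close>

datatype rcode = RZero | RSuc | RProj nat | RComp rcode "rcode list"
  | RPrec rcode rcode | RMin rcode | ROracle

inductive reval :: "(nat \<Rightarrow> nat) \<Rightarrow> rcode \<Rightarrow> nat list \<Rightarrow> nat \<Rightarrow> bool" for p where
  zero: "reval p RZero xs 0"
| suc: "reval p RSuc (x # xs) (Suc x)"
| proj: "i < length xs \<Longrightarrow> reval p (RProj i) xs (xs ! i)"
| comp: "length ys = length gs \<Longrightarrow> (\<forall>i < length gs. reval p (gs ! i) xs (ys ! i))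
          \<Longrightarrow> reval p f ys z \<Longrightarrow> reval p (RComp f gs) xs z"
| prec0: "reval p f xs y \<Longrightarrow> reval p (RPrec f g) (0 # xs) y"
| precS: "reval p (RPrec f g) (n # xs) y \<Longrightarrow> reval p g (y # n # xs) z
          \<Longrightarrow> reval p (RPrec f g) (Suc n # xs) z"
| rmin: "reval p f (n # xs) 0 \<Longrightarrow> (\<forall>k < n. \<exists>y. 0 < y \<and> reval p f (k # xs) y)
          \<Longrightarrow> reval p (RMin f) xs n"
| query: "reval p ROracle (x # xs) (p x)"

definition machine_out :: "rcode \<Rightarrow> (nat \<Rightarrow> nat) \<Rightarrow> (nat \<Rightarrow> nat) \<Rightarrow> bool" where
  "machine_out e p q \<longleftrightarrow> (\<forall>k. reval p e [k] (q k))"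

definition computable_seq :: "(nat \<Rightarrow> nat) \<Rightarrow> bool" where
  "computable_seq q \<longleftrightarrow> (\<exists>e. machine_out e (\<lambda>_. 0) q)"

definition Rn :: "nat \<Rightarrow> real list set" where
  "Rn n = {x. length x = n}"

definition edist :: "real list \<Rightarrow> real list \<Rightarrow> real" where
  "edist x y = sqrt (\<Sum>i<length x. (x ! i - y ! i)^2)"

definition open_Rn :: "nat \<Rightarrow> real list set \<Rightarrow> bool" where
  "open_Rn n U \<longleftrightarrow> U \<subseteq> Rn n \<and>
     (\<forall>x\<in>U. \<exists>r>0. \<forall>y\<in>Rn n. edist x y < r \<longrightarrow> y \<in> U)"

definition ball_Rn :: "nat \<Rightarrow> real list \<Rightarrow> real \<Rightarrow> real list set" where
  "ball_Rn n c r = {y \<in> Rn n. edist c y < r}"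

definition rat_dec :: "nat \<Rightarrow> rat" where
  "rat_dec c = Fract (int_decode (fst (prod_decode c))) (int (snd (prod_decode c)) + 1)"

definition ratlist_dec :: "nat \<Rightarrow> real list" where
  "ratlist_dec c = map (\<lambda>a. of_rat (rat_dec a)) (list_decode c)"

definition cauchy_name :: "nat \<Rightarrow> (nat \<Rightarrow> nat) \<Rightarrow> real list \<Rightarrow> bool" where
  "cauchy_name n p x \<longleftrightarrow> x \<in> Rn n \<and>
     (\<forall>k. length (ratlist_dec (p k)) = n \<and>
          (\<forall>i<n. \<bar>ratlist_dec (p k) ! i - x ! i\<bar> \<le> inverse (2 ^ k)))"

definition ball_code :: "nat \<Rightarrow> nat \<Rightarrow> real list set" where
  "ball_code n c = (case c of 0 \<Rightarrow> {}
     | Suc d \<Rightarrow> (let ctr = ratlist_dec (fst (prod_decode d));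
                     r = of_rat (rat_dec (snd (prod_decode d))) :: real
                 in if length ctr = n \<and> 0 < r then ball_Rn n ctr r else {}))"

definition theta_name :: "nat \<Rightarrow> (nat \<Rightarrow> nat) \<Rightarrow> real list set \<Rightarrow> bool" where
  "theta_name n p U \<longleftrightarrow> U = (\<Union>k. ball_code n (p k))"

definition re_open :: "nat \<Rightarrow> real list set \<Rightarrow> bool" where
  "re_open n U \<longleftrightarrow> (\<exists>p. computable_seq p \<and> theta_name n p U)"

definition computable_reals :: "real set" where
  "computable_reals = {x. \<exists>p. computable_seq p \<and> cauchy_name 1 p [x]}"

definition computable_fun :: "nat \<Rightarrow> nat \<Rightarrow> real list set \<Rightarrow> (real list \<Rightarrow> real list) \<Rightarrow> bool" where
  "computable_fun n m X f \<longleftrightarrow> (\<exists>e. \<forall>x\<in>X. \<forall>p. cauchy_name n p x \<longrightarrow>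
      (\<exists>q. cauchy_name m q (f x) \<and> machine_out e p q))"

definition open_map :: "nat \<Rightarrow> nat \<Rightarrow> real list set \<Rightarrow> (real list \<Rightarrow> real list) \<Rightarrow> bool" where
  "open_map n m X f \<longleftrightarrow> (\<forall>U. open_Rn n U \<and> U \<subseteq> X \<longrightarrow> open_Rn m (f ` U))"

definition effectively_open :: "nat \<Rightarrow> nat \<Rightarrow> real list set \<Rightarrow> (real list \<Rightarrow> real list) \<Rightarrow> bool" where
  "effectively_open n m X f \<longleftrightarrow> (\<exists>e. \<forall>U. open_Rn n U \<and> U \<subseteq> X \<longrightarrow>
      (\<forall>p. theta_name n p U \<longrightarrow> (\<exists>q. theta_name m q (f ` U) \<and> machine_out e p q)))"

text \<open>A polynomial in k variables with coefficients in F, given by its finitely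
  supported coefficient function on exponent vectors (nat lists of length k).\<close>
definition poly_over :: "real set \<Rightarrow> nat \<Rightarrow> (nat list \<Rightarrow> real) \<Rightarrow> bool" where
  "poly_over F k c \<longleftrightarrow> finite {a. c a \<noteq> 0} \<and>
     (\<forall>a. c a \<noteq> 0 \<longrightarrow> length a = k \<and> c a \<in> F)"

definition peval :: "(nat list \<Rightarrow> real) \<Rightarrow> real list \<Rightarrow> real" where
  "peval c x = (\<Sum>a\<in>{a. c a \<noteq> 0}. c a * (\<Prod>i<length a. (x ! i) ^ (a ! i)))"

definition basic_semialg :: "real set \<Rightarrow> nat \<Rightarrow> real list set \<Rightarrow> bool" where
  "basic_semialg F k S \<longleftrightarrow> (\<exists>ps qs.
     (\<forall>c\<in>set ps. poly_over F k c) \<and> (\<forall>c\<in>set qs. poly_over F k c) \<and>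
     S = {x \<in> Rn k. (\<forall>c\<in>set ps. peval c x \<ge> 0) \<and> (\<forall>c\<in>set qs. peval c x > 0)})"

definition semialg :: "real set \<Rightarrow> nat \<Rightarrow> real list set \<Rightarrow> bool" where
  "semialg F k S \<longleftrightarrow> (\<exists>L :: real list set list list.
     (\<forall>Bs\<in>set L. \<forall>B\<in>set Bs. basic_semialg F k B) \<and>
     S = (\<Union>Bs\<in>set L. Rn k \<inter> \<Inter>(set Bs)))"

definition semialg_fun :: "real set \<Rightarrow> nat \<Rightarrow> nat \<Rightarrow> real list set \<Rightarrow> (real list \<Rightarrow> real list) \<Rightarrow> bool" where
  "semialg_fun F n m X f \<longleftrightarrow> semialg F (n + m) {x @ f x | x. x \<in> X}"

end

theory Submission
  imports Defs "HOL-Computational_Algebra.Polynomial" "HOL-Analysis.L2_Norm"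
begin

text \<open>Call a set of real tuples semi-algebraic if it is a Boolean combination of sets \<open>p > 0\<close> with
  \<open>p\<close> in the ring generated by the variables and the computable reals. By quantifier elimination
  these sets are closed under projection, so the set \<open>D\<close> of all \<open>(y, s, c, r)\<close> such that the ball
  \<open>B(y, s)\<close> is contained in \<open>f[B(c, r) \<inter> X]\<close> is semi-algebraic. Since a nonzero polynomial vanishes on
  no nonempty open set, replacing \<open>p = 0\<close> by falsity for all nonzero \<open>p\<close> yields a set
  \<open>P \<subseteq> D\<close> that is defined by strict inequalities only and meets every nonempty open subset of \<open>D\<close>.
  Membership of rational points in \<open>P\<close> is semi-decidable. If \<open>U\<close> is the union of rational balls
  \<open>B(a, t)\<close>, then \<open>f[U]\<close> is the union of the \<open>B(y, s)\<close> with rational \<open>(y, s, c, r) \<in> P\<close> and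
  \<open>|a - c| + r < t\<close> for one of those balls: the parameters \<open>(c, r)\<close> may be perturbed, so the loss of
  lower-dimensional parts of \<open>D\<close> does no harm. The same argument without parameters enumerates \<open>X\<close>.

  Quantifier elimination is proved for an abstract ring of functions with a Boolean algebra containing
  their positivity sets: in a maximal such ring the roots of every polynomial over the ring are, by
  induction on the degree, values of finitely many ring elements, and an existential quantifier reduces
  to finitely many sample points.\<close>

section \<open>Recursive functionals\<close>

text \<open>The code is fixed before the oracle \<open>p\<close>, so one code serves all names, as
  \<open>machine_out\<close> requires in \<open>effectively_open\<close>. Explicit codes appear only
  for basic arithmetic and one search; later functionals are assembled from closure
  properties.\<close>

definition rec1 :: "((nat \<Rightarrow> nat) \<Rightarrow> nat \<Rightarrow> nat) \<Rightarrow> bool" where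
  "rec1 g \<longleftrightarrow> (\<exists>e. \<forall>p k. reval p e [k] (g p k))"

definition rec2 :: "(nat \<Rightarrow> nat \<Rightarrow> nat) \<Rightarrow> bool" where
  "rec2 g \<longleftrightarrow> (\<exists>e. \<forall>p x y. reval p e [x, y] (g x y))"

lemma reval_comp1: "reval p g xs y \<Longrightarrow> reval p f [y] z \<Longrightarrow> reval p (RComp f [g]) xs z"
  by (rule reval.comp[where ys = "[y]"]) auto

lemma reval_comp2:
  "reval p g xs y \<Longrightarrow> reval p h xs w \<Longrightarrow> reval p f [y, w] z \<Longrightarrow> reval p (RComp f [g, h]) xs z"
  by (rule reval.comp[where ys = "[y, w]"]) (auto simp: less_Suc_eq)

lemma reval_proj: "i < length xs \<Longrightarrow> xs ! i = y \<Longrightarrow> reval p (RProj i) xs y"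
  using reval.proj by metis

lemma rec1_id: "rec1 (\<lambda>p k. k)"
  unfolding rec1_def by (intro exI[of _ "RProj 0"] allI reval_proj) auto

lemma rec1_oracle: "rec1 g \<Longrightarrow> rec1 (\<lambda>p k. p (g p k))"
  unfolding rec1_def by (meson reval_comp1 reval.query)

lemma rec1_Suc: "rec1 g \<Longrightarrow> rec1 (\<lambda>p k. Suc (g p k))"
  unfolding rec1_def by (meson reval_comp1 reval.suc)

lemma rec1_const: "rec1 (\<lambda>p k. c)"
proof (induction c)
  case 0
  show ?case unfolding rec1_def by (meson reval.zero)
qed (rule rec1_Suc)

lemma rec1_compose:
  assumes "rec1 (\<lambda>p. f)" "rec1 g" shows "rec1 (\<lambda>p k. f (g p k))"
  using assms unfolding rec1_def by (meson reval_comp1)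

lemma rec1_subst:
  assumes "rec1 f" "rec1 g" shows "rec1 (\<lambda>p k. f p (g p k))"
  using assms unfolding rec1_def by (meson reval_comp1)

lemma rec1_compose2:
  assumes "rec2 f" "rec1 g" "rec1 h" shows "rec1 (\<lambda>p k. f (g p k) (h p k))"
  using assms unfolding rec1_def rec2_def by (meson reval_comp2)

lemma rec2_add: "rec2 (+)"
proof -
  have "reval p (RPrec (RProj 0) (RComp RSuc [RProj 0])) [x, y] (x + y)" for p x y
  proof (induction x)
    case 0
    show ?case by (auto intro!: reval.prec0 reval_proj)
  next
    case (Suc x)
    have "reval p (RComp RSuc [RProj 0]) [x + y, x, y] (Suc (x + y))"
      by (rule reval_comp1[OF reval_proj reval.suc]) auto
    then show ?case using reval.precS[OF Suc] by simp
  qed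
  then show ?thesis unfolding rec2_def by blast
qed

lemma rec2_mult: "rec2 (*)"
proof -
  obtain a where a: "\<And>p x y. reval p a [x, y] (x + y)"
    using rec2_add unfolding rec2_def by blast
  have "reval p (RPrec RZero (RComp a [RProj 2, RProj 0])) [x, y] (x * y)" for p x y
  proof (induction x)
    case 0
    show ?case by (auto intro!: reval.prec0 reval.zero)
  next
    case (Suc x)
    have "reval p (RComp a [RProj 2, RProj 0]) [x * y, x, y] (y + x * y)"
      by (rule reval_comp2[OF reval_proj reval_proj a]) auto
    then show ?case using reval.precS[OF Suc] by simp
  qed
  then show ?thesis unfolding rec2_def by blast
qed

lemma rec2_diff: "rec2 (-)"
proof -
  let ?d = "RPrec RZero (RProj 1)"
  have d: "reval p ?d [x] (x - 1)" for p x
  proof (induction x)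
    case 0
    show ?case by (auto intro!: reval.prec0 reval.zero)
  next
    case (Suc x)
    have "reval p (RProj 1) [x - 1, x] x" by (rule reval_proj) auto
    then show ?case using reval.precS[OF Suc] by simp
  qed
  \<comment> \<open>\<open>RPrec\<close> recurses on its first argument, so iterating the
    predecessor \<open>?d\<close> subtracts in the wrong order; the two projections below swap the
    arguments back.\<close>
  let ?m = "RPrec (RProj 0) (RComp ?d [RProj 0])"
  have m: "reval p ?m [x, y] (y - x)" for p x y
  proof (induction x)
    case 0
    show ?case by (auto intro!: reval.prec0 reval_proj)
  next
    case (Suc x)
    have "reval p (RComp ?d [RProj 0]) [y - x, x, y] (y - x - 1)"
      by (rule reval_comp1[OF reval_proj d]) auto
    then show ?case using reval.precS[OF Suc] by simp
  qed
  have "reval p (RComp ?m [RProj 1, RProj 0]) [x, y] (x - y)" for p x y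
    by (rule reval_comp2[OF reval_proj reval_proj m]) auto
  then show ?thesis unfolding rec2_def by blast
qed

lemmas rec1_add = rec1_compose2[OF rec2_add]
  and rec1_mult = rec1_compose2[OF rec2_mult]
  and rec1_diff = rec1_compose2[OF rec2_diff]

lemma rec1_triangle: "rec1 (\<lambda>p. triangle)"
proof -
  obtain a where a: "\<And>p x y. reval p a [x, y] (x + y)"
    using rec2_add unfolding rec2_def by blast
  have "reval p (RPrec RZero (RComp a [RProj 0, RComp RSuc [RProj 1]])) [x] (triangle x)" for p x
  proof (induction x)
    case 0
    show ?case by (auto intro!: reval.prec0 reval.zero)
  next
    case (Suc x)
    have "reval p (RComp a [RProj 0, RComp RSuc [RProj 1]]) [triangle x, x] (triangle x + Suc x)"
      by (rule reval_comp2[OF reval_proj reval_comp1[OF reval_proj reval.suc] a]) auto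
    then show ?case using reval.precS[OF Suc] by simp
  qed
  then show ?thesis unfolding rec1_def by blast
qed

text \<open>The truncated difference \<open>Suc k - F n\<close> vanishes exactly when
  \<open>k < F n\<close>, and unboundedness of \<open>F\<close> makes the search by
  \<open>RMin\<close> total. It supplies triangular roots and halving.\<close>

lemma rec1_Least_bound:
  assumes F: "rec1 (\<lambda>p. F)" and unbounded: "\<And>k. \<exists>n. k < F n"
  shows "rec1 (\<lambda>p k. LEAST n. k < F n)"
proof -
  obtain f where f: "\<And>p n. reval p f [n] (F n)"
    using F unfolding rec1_def by blast
  obtain d where d: "\<And>p x y. reval p d [x, y] (x - y)"
    using rec2_diff unfolding rec2_def by blast
  let ?t = "RComp d [RComp RSuc [RProj 1], RComp f [RProj 0]]"
  have t: "reval p ?t [n, k] (Suc k - F n)" for p n k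
    by (rule reval_comp2[OF reval_comp1[OF reval_proj reval.suc] reval_comp1[OF reval_proj f] d]) auto
  have "reval p (RMin ?t) [k] (LEAST n. k < F n)" for p k
  proof (rule reval.rmin)
    have "k < F (LEAST n. k < F n)" using unbounded by (rule LeastI_ex)
    then show "reval p ?t [LEAST n. k < F n, k] 0"
      using t[of p "LEAST n. k < F n" k] by (simp add: Suc_le_eq)
    show "\<forall>j<(LEAST n. k < F n). \<exists>y>0. reval p ?t [j, k] y"
    proof (intro allI impI)
      fix j assume "j < (LEAST n. k < F n)"
      then have "F j \<le> k" using not_less_Least by force
      then show "\<exists>y>0. reval p ?t [j, k] y" using t[of p j k] by (intro exI[of _ "Suc k - F j"]) auto
    qed
  qed
  then show ?thesis unfolding rec1_def by blast
qed

lemma triangle_mono: "m \<le> n \<Longrightarrow> triangle m \<le> triangle n"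
  by (induction n) (auto simp: le_Suc_eq)

text \<open>Cantor pairing runs through diagonals: \<open>k\<close> lies on the diagonal
  \<open>t k\<close>, the sum of its components, at position \<open>k - triangle (t k)\<close>.
  Decoding thus reduces to subtraction and a search.\<close>

lemma prod_decode_Least:
  defines "t k \<equiv> LEAST n. k < triangle (Suc n)"
  shows "fst (prod_decode k) = k - triangle (t k)" "snd (prod_decode k) = t k - (k - triangle (t k))"
proof -
  obtain a b where ab: "prod_decode k = (a, b)" by (cases "prod_decode k")
  then have k: "k = triangle (a + b) + a"
    using prod_decode_inverse[of k] by (simp add: prod_encode_def)
  have "t k = a + b"
    unfolding t_def
  proof (rule Least_equality)
    show "k < triangle (Suc (a + b))" using k by simp
    fix n assume n: "k < triangle (Suc n)"
    show "a + b \<le> n"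
    proof (rule ccontr)
      assume "\<not> a + b \<le> n"
      then have "triangle (Suc n) \<le> triangle (a + b)" by (intro triangle_mono) simp
      then show False using n k by simp
    qed
  qed
  then show "fst (prod_decode k) = k - triangle (t k)" "snd (prod_decode k) = t k - (k - triangle (t k))"
    using k ab by auto
qed

lemma rec1_triangle_root: "rec1 (\<lambda>p k. LEAST n. k < triangle (Suc n))"
proof (rule rec1_Least_bound)
  show "rec1 (\<lambda>p n. triangle (Suc n))"
    by (rule rec1_compose[OF rec1_triangle rec1_Suc[OF rec1_id]])
  show "\<exists>n. k < triangle (Suc n)" for k by (rule exI[of _ k]) simp
qed

lemma rec1_fst: "rec1 g \<Longrightarrow> rec1 (\<lambda>p k. fst (prod_decode (g p k)))"
  unfolding prod_decode_Least
  by (intro rec1_diff rec1_compose[OF rec1_triangle] rec1_compose[OF rec1_triangle_root])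

lemma rec1_snd: "rec1 g \<Longrightarrow> rec1 (\<lambda>p k. snd (prod_decode (g p k)))"
  unfolding prod_decode_Least
  by (intro rec1_diff rec1_compose[OF rec1_triangle] rec1_compose[OF rec1_triangle_root])

lemma rec1_pair:
  assumes "rec1 g" "rec1 h" shows "rec1 (\<lambda>p k. prod_encode (g p k, h p k))"
  unfolding prod_encode_def prod.case
  by (intro rec1_add rec1_compose[OF rec1_triangle] assms)

lemma rec1_if:
  assumes "rec1 c" "rec1 g" "rec1 h"
  shows "rec1 (\<lambda>p k. if c p k = 0 then g p k else h p k)"
proof -
  \<comment> \<open>In truncated arithmetic \<open>1 - c\<close> is 1 for \<open>c = 0\<close> and 0
    otherwise.\<close>
  have "(\<lambda>p k. if c p k = 0 then g p k else h p k)
     = (\<lambda>p k. (1 - c p k) * g p k + (1 - (1 - c p k)) * h p k)" by (intro ext) auto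
  then show ?thesis
    by (simp only:) (intro rec1_add rec1_mult rec1_diff rec1_const assms)
qed

lemma div2_Least: "(k::nat) div 2 = (LEAST n. k < 2 * Suc n)"
  by (rule Least_equality[symmetric]) auto

lemma rec1_div2: "rec1 g \<Longrightarrow> rec1 (\<lambda>p k. g p k div 2)"
proof -
  have "rec1 (\<lambda>p k. LEAST n. k < 2 * Suc n)"
  proof (rule rec1_Least_bound)
    show "rec1 (\<lambda>p n. 2 * Suc n)" by (intro rec1_mult rec1_const rec1_Suc rec1_id)
    show "\<exists>n. k < 2 * Suc n" for k by (rule exI[of _ k]) simp
  qed
  then show "rec1 g \<Longrightarrow> rec1 (\<lambda>p k. g p k div 2)"
    unfolding div2_Least by (rule rec1_compose)
qed

text \<open>On codes that are not those of long enough lists, the entries are junk.\<close>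
definition code_tl :: "nat \<Rightarrow> nat" where "code_tl k = snd (prod_decode (k - 1))"
definition code_nth :: "nat \<Rightarrow> nat \<Rightarrow> nat" where
  "code_nth k i = fst (prod_decode ((code_tl ^^ i) k - 1))"

lemma rec1_code_tl: "rec1 g \<Longrightarrow> rec1 (\<lambda>p k. (code_tl ^^ i) (g p k))"
proof (induction i)
  case (Suc i)
  show ?case
    unfolding funpow.simps o_def code_tl_def[of "(code_tl ^^ i) _"]
    by (intro rec1_snd rec1_diff rec1_const Suc.IH Suc.prems)
qed simp

lemma rec1_code_nth: "rec1 g \<Longrightarrow> rec1 (\<lambda>p k. code_nth (g p k) i)"
  unfolding code_nth_def by (intro rec1_fst rec1_diff rec1_const rec1_code_tl)

lemma code_tl_funpow_encode:
  "i \<le> length xs \<Longrightarrow> (code_tl ^^ i) (list_encode xs) = list_encode (drop i xs)"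
proof (induction i arbitrary: xs)
  case (Suc i)
  then obtain x ys where "xs = x # ys" by (cases xs) auto
  then show ?case using Suc
    by (simp add: funpow_Suc_right code_tl_def del: funpow.simps)
qed simp

lemma code_nth_encode: "i < length xs \<Longrightarrow> code_nth (list_encode xs) i = xs ! i"
  by (simp add: code_nth_def code_tl_funpow_encode Cons_nth_drop_Suc[symmetric])

lemma code_nth_decode: "i < length (list_decode k) \<Longrightarrow> code_nth k i = list_decode k ! i"
  by (metis code_nth_encode list_decode_inverse)

text \<open>For fixed \<open>n\<close>, the length test becomes finitely many zero tests on iterated
  tails, which are semi-decidable one by one.\<close>

lemma length_list_decode_eq:
  "length (list_decode k) = n \<longleftrightarrow> (\<forall>i<n. (code_tl ^^ i) k \<noteq> 0) \<and> (code_tl ^^ n) k = 0"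
proof (induction n arbitrary: k)
  case 0
  show ?case by (cases k) (auto split: prod.splits)
next
  case (Suc n)
  show ?case
  proof (cases k)
    case (Suc j)
    have "length (list_decode k) = Suc (length (list_decode (code_tl k)))"
      using Suc by (simp add: code_tl_def split: prod.splits)
    moreover have "(\<forall>i<Suc n. (code_tl ^^ i) k \<noteq> 0) \<longleftrightarrow> (\<forall>i<n. (code_tl ^^ i) (code_tl k) \<noteq> 0)"
      using Suc by (auto simp: less_Suc_eq_0_disj funpow_Suc_right simp del: funpow.simps)
    ultimately show ?thesis using Suc.IH[of "code_tl k"]
      by (simp add: funpow_Suc_right del: funpow.simps)
  qed auto
qed

lemma rec1_list_encode:
  assumes "\<And>i. i < n \<Longrightarrow> rec1 (g i)"
  shows "rec1 (\<lambda>p k. list_encode (map (\<lambda>i. g i p k) [0..<n]))"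
proof -
  have "\<forall>i\<in>set is. rec1 (g i) \<Longrightarrow> rec1 (\<lambda>p k. list_encode (map (\<lambda>i. g i p k) is))" for "is"
    by (induction "is" rule: list.induct) (auto intro!: rec1_const rec1_Suc rec1_pair)
  then show ?thesis using assms by simp
qed

section \<open>Rational-valued functionals\<close>

text \<open>The difference carries the sign and \<open>c + 1\<close> keeps the denominator positive.
  Fractions are not reduced, so ring operations need only natural addition and multiplication, and
  the sign is that of \<open>a - b\<close>.\<close>

definition rrat :: "((nat \<Rightarrow> nat) \<Rightarrow> nat \<Rightarrow> real) \<Rightarrow> bool" where
  "rrat g \<longleftrightarrow> (\<exists>a b c. rec1 a \<and> rec1 b \<and> rec1 c \<and>
     (\<forall>p k. g p k = (real (a p k) - real (b p k)) / (real (c p k) + 1)))"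

lemma rrat_of_nat: "rec1 g \<Longrightarrow> rrat (\<lambda>p k. real (g p k))"
  unfolding rrat_def
  by (rule exI[of _ g], rule exI[of _ "\<lambda>p k. 0"], rule exI[of _ "\<lambda>p k. 0"])
    (simp add: rec1_const)

lemma rrat_inverse_Suc: "rec1 g \<Longrightarrow> rrat (\<lambda>p k. 1 / (real (g p k) + 1))"
  unfolding rrat_def
  by (rule exI[of _ "\<lambda>p k. 1"], rule exI[of _ "\<lambda>p k. 0"], rule exI[of _ g])
    (simp add: rec1_const)

lemma rrat_subst:
  assumes "rrat f" "rec1 g" shows "rrat (\<lambda>p k. f p (g p k))"
proof -
  obtain a b c where rec: "rec1 a" "rec1 b" "rec1 c"
    and f: "\<And>p k. f p k = (real (a p k) - real (b p k)) / (real (c p k) + 1)"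
    using assms(1) unfolding rrat_def by blast
  show ?thesis
    unfolding rrat_def f using rec[THEN rec1_subst[OF _ assms(2)]] by blast
qed

lemma rrat_minus:
  assumes "rrat f" shows "rrat (\<lambda>p k. - f p k)"
proof -
  obtain a b c where rec: "rec1 a" "rec1 b" "rec1 c"
    and f: "\<And>p k. f p k = (real (a p k) - real (b p k)) / (real (c p k) + 1)"
    using assms unfolding rrat_def by blast
  show ?thesis
    unfolding rrat_def f using rec by (metis minus_diff_eq minus_divide_left)
qed

lemma rrat_add:
  assumes "rrat f" "rrat g" shows "rrat (\<lambda>p k. f p k + g p k)"
proof -
  obtain a b c a' b' c' where rec: "rec1 a" "rec1 b" "rec1 c" "rec1 a'" "rec1 b'" "rec1 c'"
    and f: "\<And>p k. f p k = (real (a p k) - real (b p k)) / (real (c p k) + 1)"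
    and g: "\<And>p k. g p k = (real (a' p k) - real (b' p k)) / (real (c' p k) + 1)"
    using assms unfolding rrat_def by blast
  let ?A = "\<lambda>p k. a p k * Suc (c' p k) + a' p k * Suc (c p k)"
  let ?B = "\<lambda>p k. b p k * Suc (c' p k) + b' p k * Suc (c p k)"
  let ?C = "\<lambda>p k. c p k * c' p k + c p k + c' p k"
  have "f p k + g p k = (real (?A p k) - real (?B p k)) / (real (?C p k) + 1)" for p k
  proof -
    have C: "real (?C p k) + 1 = (real (c p k) + 1) * (real (c' p k) + 1)"
      by (simp add: algebra_simps)
    show ?thesis unfolding C f g
      by (subst add_frac_eq) (auto simp: algebra_simps add_eq_0_iff)
  qed
  moreover have "rec1 ?A" "rec1 ?B" "rec1 ?C"
    by (intro rec1_add rec1_mult rec1_Suc rec)+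
  ultimately show ?thesis unfolding rrat_def by blast
qed

lemma rrat_mult:
  assumes "rrat f" "rrat g" shows "rrat (\<lambda>p k. f p k * g p k)"
proof -
  obtain a b c a' b' c' where rec: "rec1 a" "rec1 b" "rec1 c" "rec1 a'" "rec1 b'" "rec1 c'"
    and f: "\<And>p k. f p k = (real (a p k) - real (b p k)) / (real (c p k) + 1)"
    and g: "\<And>p k. g p k = (real (a' p k) - real (b' p k)) / (real (c' p k) + 1)"
    using assms unfolding rrat_def by blast
  let ?A = "\<lambda>p k. a p k * a' p k + b p k * b' p k"
  let ?B = "\<lambda>p k. a p k * b' p k + b p k * a' p k"
  let ?C = "\<lambda>p k. c p k * c' p k + c p k + c' p k"
  have "f p k * g p k = (real (?A p k) - real (?B p k)) / (real (?C p k) + 1)" for p k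
  proof -
    have C: "real (?C p k) + 1 = (real (c p k) + 1) * (real (c' p k) + 1)"
      by (simp add: algebra_simps)
    show ?thesis unfolding C f g by (simp add: algebra_simps)
  qed
  moreover have "rec1 ?A" "rec1 ?B" "rec1 ?C"
    by (intro rec1_add rec1_mult rec)+
  ultimately show ?thesis unfolding rrat_def by blast
qed

lemma rrat_diff: "rrat f \<Longrightarrow> rrat g \<Longrightarrow> rrat (\<lambda>p k. f p k - g p k)"
  using rrat_add[of f "\<lambda>p k. - g p k"] rrat_minus by simp

lemma rrat_abs:
  assumes "rrat f" shows "rrat (\<lambda>p k. \<bar>f p k\<bar>)"
proof -
  obtain a b c where rec: "rec1 a" "rec1 b" "rec1 c"
    and f: "\<And>p k. f p k = (real (a p k) - real (b p k)) / (real (c p k) + 1)"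
    using assms unfolding rrat_def by blast
  \<comment> \<open>At most one of the two truncated differences is nonzero, so their sum is the
    absolute value.\<close>
  let ?A = "\<lambda>p k. (a p k - b p k) + (b p k - a p k)"
  have "\<bar>f p k\<bar> = (real (?A p k) - real 0) / (real (c p k) + 1)" for p k
    unfolding f abs_divide
    by (cases "a p k \<le> b p k") (auto simp: of_nat_diff)
  moreover have "rec1 ?A" by (intro rec1_add rec1_diff rec)
  ultimately show ?thesis unfolding rrat_def using rec rec1_const[of 0] by blast
qed

lemma rrat_rat_dec:
  assumes "rec1 g" shows "rrat (\<lambda>p k. of_rat (rat_dec (g p k)))"
proof -
  let ?n = "\<lambda>p k. fst (prod_decode (g p k))"
  \<comment> \<open>\<open>?odd\<close> is the parity of the numerator code \<open>n\<close>:
    \<open>int_decode\<close> sends even codes to \<open>n div 2\<close> and odd ones to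
    \<open>- Suc (n div 2)\<close>.\<close>
  let ?odd = "\<lambda>p k. ?n p k - 2 * (?n p k div 2)"
  let ?a = "\<lambda>p k. if ?odd p k = 0 then ?n p k div 2 else 0"
  let ?b = "\<lambda>p k. if ?odd p k = 0 then 0 else Suc (?n p k div 2)"
  let ?c = "\<lambda>p k. snd (prod_decode (g p k))"
  have "rec1 ?a" "rec1 ?b" "rec1 ?c"
    by (intro rec1_if rec1_diff rec1_mult rec1_const rec1_div2 rec1_Suc rec1_fst rec1_snd assms)+
  moreover have "of_rat (rat_dec (g p k)) = (real (?a p k) - real (?b p k)) / (real (?c p k) + 1)" for p k
  proof -
    have "real_of_int (int_decode n) = real (if n - 2 * (n div 2) = 0 then n div 2 else 0)
        - real (if n - 2 * (n div 2) = 0 then 0 else Suc (n div 2))" for n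
      unfolding int_decode_def sum_decode_def by (auto elim!: evenE oddE)
    then show ?thesis unfolding rat_dec_def by (simp add: of_rat_rat)
  qed
  ultimately show ?thesis unfolding rrat_def by blast
qed

lemma ex_rat_dec: "x \<in> \<rat> \<Longrightarrow> \<exists>k. of_rat (rat_dec k) = (x::real)"
proof -
  assume "x \<in> \<rat>"
  then obtain r where r: "x = of_rat r" by (auto elim: Rats_cases)
  obtain a b where ab: "r = Fract a b" "b > 0" by (cases r) auto
  have "rat_dec (prod_encode (int_encode a, nat (b - 1))) = r"
    using ab by (simp add: rat_dec_def)
  then show ?thesis using r by blast
qed

section \<open>Real-valued functionals given by approximations\<close>

text \<open>The error bounds \<open>d\<close> are computed along with the approximations
  \<open>a\<close> and only have to tend to 0 with the stage \<open>s\<close>. Sums and products can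
  then be formed at the same stage, without rescaling a modulus of convergence.\<close>

definition creal :: "((nat \<Rightarrow> nat) \<Rightarrow> nat \<Rightarrow> real) \<Rightarrow> bool" where
  "creal g \<longleftrightarrow> (\<exists>a d. rrat a \<and> rrat d \<and>
     (\<forall>p k s. \<bar>a p (prod_encode (k, s)) - g p k\<bar> \<le> d p (prod_encode (k, s))) \<and>
     (\<forall>p k. (\<lambda>s. d p (prod_encode (k, s))) \<longlonglongrightarrow> 0))"

lemma creal_rrat: "rrat g \<Longrightarrow> creal g"
  unfolding creal_def
  by (rule exI[of _ "\<lambda>p k. g p (fst (prod_decode k))"], rule exI[of _ "\<lambda>p k. 0"])
    (use rrat_of_nat[OF rec1_const[of 0]] in \<open>auto intro!: rrat_subst rec1_fst rec1_id\<close>)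

lemma creal_add:
  assumes "creal f" "creal g" shows "creal (\<lambda>p k. f p k + g p k)"
proof -
  obtain a d where f: "rrat a" "rrat d"
    "\<And>p k s. \<bar>a p (prod_encode (k, s)) - f p k\<bar> \<le> d p (prod_encode (k, s))"
    "\<And>p k. (\<lambda>s. d p (prod_encode (k, s))) \<longlonglongrightarrow> 0"
    using assms(1) unfolding creal_def by blast
  obtain a' d' where g: "rrat a'" "rrat d'"
    "\<And>p k s. \<bar>a' p (prod_encode (k, s)) - g p k\<bar> \<le> d' p (prod_encode (k, s))"
    "\<And>p k. (\<lambda>s. d' p (prod_encode (k, s))) \<longlonglongrightarrow> 0"
    using assms(2) unfolding creal_def by blast
  show ?thesis
    unfolding creal_def
  proof (intro exI conjI allI)
    show "rrat (\<lambda>p k. a p k + a' p k)" "rrat (\<lambda>p k. d p k + d' p k)"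
      by (intro rrat_add f g)+
    show "\<bar>a p (prod_encode (k, s)) + a' p (prod_encode (k, s)) - (f p k + g p k)\<bar>
        \<le> d p (prod_encode (k, s)) + d' p (prod_encode (k, s))" for p k s
      using f(3)[of p k s] g(3)[of p k s] by linarith
    show "(\<lambda>s. d p (prod_encode (k, s)) + d' p (prod_encode (k, s))) \<longlonglongrightarrow> 0" for p k
      using tendsto_add[OF f(4)[of p k] g(4)[of p k]] by simp
  qed
qed

lemma creal_mult:
  assumes "creal f" "creal g" shows "creal (\<lambda>p k. f p k * g p k)"
proof -
  obtain a d where f: "rrat a" "rrat d"
    "\<And>p k s. \<bar>a p (prod_encode (k, s)) - f p k\<bar> \<le> d p (prod_encode (k, s))"
    "\<And>p k. (\<lambda>s. d p (prod_encode (k, s))) \<longlonglongrightarrow> 0"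
    using assms(1) unfolding creal_def by blast
  obtain a' d' where g: "rrat a'" "rrat d'"
    "\<And>p k s. \<bar>a' p (prod_encode (k, s)) - g p k\<bar> \<le> d' p (prod_encode (k, s))"
    "\<And>p k. (\<lambda>s. d' p (prod_encode (k, s))) \<longlonglongrightarrow> 0"
    using assms(2) unfolding creal_def by blast
  show ?thesis
    unfolding creal_def
  proof (intro exI conjI allI)
    show "rrat (\<lambda>p k. a p k * a' p k)"
      "rrat (\<lambda>p k. \<bar>a p k\<bar> * d' p k + \<bar>a' p k\<bar> * d p k + d p k * d' p k)"
      by (intro rrat_add rrat_mult rrat_abs f g)+
    fix p k
    let ?a = "\<lambda>s. a p (prod_encode (k, s))" and ?a' = "\<lambda>s. a' p (prod_encode (k, s))"
      and ?d = "\<lambda>s. d p (prod_encode (k, s))" and ?d' = "\<lambda>s. d' p (prod_encode (k, s))"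
    show "\<bar>?a s * ?a' s - f p k * g p k\<bar> \<le> \<bar>?a s\<bar> * ?d' s + \<bar>?a' s\<bar> * ?d s + ?d s * ?d' s" for s
    proof -
      have tri: "\<bar>x + y - z\<bar> \<le> \<bar>x\<bar> + \<bar>y\<bar> + \<bar>z\<bar>" for x y z :: real by linarith
      let ?x = "?a s - f p k" and ?y = "?a' s - g p k"
      \<comment> \<open>Expanding around the approximations instead of the exact values keeps the
        error bound computable from \<open>a\<close>, \<open>a'\<close>, \<open>d\<close> and
        \<open>d'\<close>.\<close>
      have "?a s * ?a' s - f p k * g p k = ?a s * ?y + ?a' s * ?x - ?x * ?y"
        by (simp add: algebra_simps)
      then have "\<bar>?a s * ?a' s - f p k * g p k\<bar> \<le> \<bar>?a s * ?y\<bar> + \<bar>?a' s * ?x\<bar> + \<bar>?x * ?y\<bar>"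
        by (simp only: tri)
      moreover have "\<bar>?a s * ?y\<bar> \<le> \<bar>?a s\<bar> * ?d' s" "\<bar>?a' s * ?x\<bar> \<le> \<bar>?a' s\<bar> * ?d s"
        unfolding abs_mult by (intro mult_left_mono f(3) g(3) abs_ge_zero)+
      moreover have "\<bar>?x * ?y\<bar> \<le> ?d s * ?d' s"
        unfolding abs_mult
        by (rule mult_mono[OF f(3) g(3) order_trans[OF abs_ge_zero f(3)] abs_ge_zero])
      ultimately show ?thesis by linarith
    qed
    have lim: "u \<longlonglongrightarrow> l" if "\<And>s. \<bar>u s - l\<bar> \<le> v s" "v \<longlonglongrightarrow> 0" for u v :: "nat \<Rightarrow> real" and l
    proof (rule LIM_zero_cancel, rule tendsto_rabs_zero_cancel)
      show "(\<lambda>s. \<bar>u s - l\<bar>) \<longlonglongrightarrow> 0"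
        by (rule tendsto_sandwich[OF _ _ tendsto_const that(2)]) (use that(1) in auto)
    qed
    have "(\<lambda>s. \<bar>?a s\<bar> * ?d' s + \<bar>?a' s\<bar> * ?d s + ?d s * ?d' s)
        \<longlonglongrightarrow> \<bar>f p k\<bar> * 0 + \<bar>g p k\<bar> * 0 + 0 * 0"
      by (intro tendsto_add tendsto_mult tendsto_rabs f(4) g(4) lim[OF f(3) f(4)] lim[OF g(3) g(4)])
    then show "(\<lambda>s. \<bar>?a s\<bar> * ?d' s + \<bar>?a' s\<bar> * ?d s + ?d s * ?d' s) \<longlonglongrightarrow> 0" by simp
  qed
qed

text \<open>\<open>computable_seq\<close> runs a code on the zero oracle. With every query replaced
  by the constant 0 the code has the same values on all oracles, so computable coefficients remain
  available while the oracle is a name of an open set.\<close>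

fun drop_oracle :: "rcode \<Rightarrow> rcode" where
  "drop_oracle RZero = RZero"
| "drop_oracle RSuc = RSuc"
| "drop_oracle (RProj i) = RProj i"
| "drop_oracle (RComp f gs) = RComp (drop_oracle f) (map drop_oracle gs)"
| "drop_oracle (RPrec f g) = RPrec (drop_oracle f) (drop_oracle g)"
| "drop_oracle (RMin f) = RMin (drop_oracle f)"
| "drop_oracle ROracle = RZero"

lemma reval_drop_oracle: "reval (\<lambda>_. 0) e xs y \<Longrightarrow> reval p (drop_oracle e) xs y"
proof (induction rule: reval.induct)
  case (comp ys gs xs f z)
  then show ?case by (auto intro!: reval.comp[where ys = ys])
next
  case (rmin f n xs)
  then show ?case by (auto intro!: reval.rmin)
qed (auto intro: reval.intros)

lemma computable_seq_rec1: "computable_seq q \<Longrightarrow> rec1 (\<lambda>p. q)"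
  unfolding computable_seq_def machine_out_def rec1_def using reval_drop_oracle by blast

lemma creal_computable_real:
  assumes "x \<in> computable_reals" shows "creal (\<lambda>p k. x)"
proof -
  obtain q where q: "computable_seq q" "cauchy_name 1 q [x]"
    using assms unfolding computable_reals_def by blast
  define a where "a k = (of_rat (rat_dec (code_nth (q k) 0)) :: real)" for k
  have a: "\<bar>a k - x\<bar> \<le> 1 / (real k + 1)" for k
  proof -
    have len: "length (ratlist_dec (q k)) = 1"
      and 1: "\<bar>ratlist_dec (q k) ! 0 - x\<bar> \<le> inverse (2 ^ k)"
      using q(2) unfolding cauchy_name_def by auto
    from len have "length (list_decode (q k)) = 1" unfolding ratlist_dec_def by simp
    then have "ratlist_dec (q k) ! 0 = a k"
      by (simp add: ratlist_dec_def a_def code_nth_decode)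
    \<comment> \<open>The exponential rate is weakened to a bound that
      \<open>rrat_inverse_Suc\<close> provides.\<close>
    moreover have "inverse (2 ^ k) \<le> 1 / (real k + 1)"
    proof -
      have "Suc k \<le> 2 ^ k" by (induction k) auto
      then have "real (Suc k) \<le> real (2 ^ k)" by (simp only: of_nat_le_iff)
      then show ?thesis by (simp add: field_simps)
    qed
    ultimately show ?thesis using 1 by simp
  qed
  have "rrat (\<lambda>p k. a (snd (prod_decode k)))"
    unfolding a_def by (intro rrat_rat_dec rec1_code_nth
      rec1_compose[OF computable_seq_rec1[OF q(1)]] rec1_snd rec1_id)
  moreover have "rrat (\<lambda>p k. 1 / (real (snd (prod_decode k)) + 1))"
    by (intro rrat_inverse_Suc rec1_snd rec1_id)
  moreover have "(\<lambda>s. 1 / (real s + 1)) \<longlonglongrightarrow> 0"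
    using LIMSEQ_inverse_real_of_nat by (simp add: inverse_eq_divide ac_simps)
  ultimately show ?thesis
    unfolding creal_def
    by (intro exI[of _ "\<lambda>p k. a (snd (prod_decode k))"]
        exI[of _ "\<lambda>p k. 1 / (real (snd (prod_decode k)) + 1)"]) (use a in auto)
qed

section \<open>Semi-decidable predicates and names of open sets\<close>

text \<open>Argument and stage are paired because \<open>rec1\<close> covers functionals with a
  single numerical argument.\<close>

definition semidec :: "((nat \<Rightarrow> nat) \<Rightarrow> nat \<Rightarrow> bool) \<Rightarrow> bool" where
  "semidec Q \<longleftrightarrow> (\<exists>t. rec1 t \<and> (\<forall>p k. Q p k \<longleftrightarrow> (\<exists>s. t p (prod_encode (k, s)) \<noteq> 0)))"

lemma semidec_conj:
  assumes "semidec Q" "semidec R" shows "semidec (\<lambda>p k. Q p k \<and> R p k)"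
proof -
  obtain t where t: "rec1 t" "\<And>p k. Q p k \<longleftrightarrow> (\<exists>s. t p (prod_encode (k, s)) \<noteq> 0)"
    using assms(1) unfolding semidec_def by blast
  obtain u where u: "rec1 u" "\<And>p k. R p k \<longleftrightarrow> (\<exists>s. u p (prod_encode (k, s)) \<noteq> 0)"
    using assms(2) unfolding semidec_def by blast
  \<comment> \<open>The stage is itself read as a pair: one witness for each conjunct.\<close>
  let ?l = "\<lambda>k. prod_encode (fst (prod_decode k), fst (prod_decode (snd (prod_decode k))))"
  let ?r = "\<lambda>k. prod_encode (fst (prod_decode k), snd (prod_decode (snd (prod_decode k))))"
  have "rec1 (\<lambda>p k. t p (?l k) * u p (?r k))"
    by (intro rec1_mult rec1_subst[OF t(1)] rec1_subst[OF u(1)] rec1_pair rec1_fst rec1_snd rec1_id)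
  moreover have "Q p k \<and> R p k \<longleftrightarrow>
      (\<exists>s. t p (?l (prod_encode (k, s))) * u p (?r (prod_encode (k, s))) \<noteq> 0)" for p k
  proof
    assume "Q p k \<and> R p k"
    then obtain s s' where "t p (prod_encode (k, s)) \<noteq> 0" "u p (prod_encode (k, s')) \<noteq> 0"
      using t u by blast
    then show "\<exists>s. t p (?l (prod_encode (k, s))) * u p (?r (prod_encode (k, s))) \<noteq> 0"
      by (intro exI[of _ "prod_encode (s, s')"]) auto
  qed (use t u in auto)
  ultimately show ?thesis unfolding semidec_def by blast
qed

lemma semidec_disj:
  assumes "semidec Q" "semidec R" shows "semidec (\<lambda>p k. Q p k \<or> R p k)"
proof -
  obtain t where t: "rec1 t" "\<And>p k. Q p k \<longleftrightarrow> (\<exists>s. t p (prod_encode (k, s)) \<noteq> 0)"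
    using assms(1) unfolding semidec_def by blast
  obtain u where u: "rec1 u" "\<And>p k. R p k \<longleftrightarrow> (\<exists>s. u p (prod_encode (k, s)) \<noteq> 0)"
    using assms(2) unfolding semidec_def by blast
  have "rec1 (\<lambda>p k. t p k + u p k)" by (intro rec1_add t u)
  then show ?thesis unfolding semidec_def using t u by (intro exI[of _ "\<lambda>p k. t p k + u p k"]) auto
qed

lemma semidec_neq_0:
  assumes "rec1 g" shows "semidec (\<lambda>p k. g p k \<noteq> 0)"
  unfolding semidec_def
  by (intro exI[of _ "\<lambda>p k. g p (fst (prod_decode k))"] conjI rec1_subst[OF assms] rec1_fst rec1_id) auto

lemma semidec_eq_0:
  assumes "rec1 g" shows "semidec (\<lambda>p k. g p k = 0)"
  using semidec_neq_0[OF rec1_diff[OF rec1_const[of 1] assms]] by (simp add: not_le)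

lemma semidec_ball_less: "(\<And>i. i < (n::nat) \<Longrightarrow> semidec (Q i)) \<Longrightarrow> semidec (\<lambda>p k. \<forall>i<n. Q i p k)"
proof (induction n)
  case 0
  show ?case using semidec_neq_0[OF rec1_const[of 1]] by simp
next
  case (Suc n)
  then have "semidec (\<lambda>p k. Q n p k \<and> (\<forall>i<n. Q i p k))" by (intro semidec_conj) auto
  then show ?case by (simp add: All_less_Suc)
qed

text \<open>A value is positive iff at some stage the approximation exceeds its error bound. At a
  fixed stage this compares rationals, hence tests a truncated difference of numerators.\<close>

lemma semidec_pos:
  assumes "creal g" shows "semidec (\<lambda>p k. 0 < g p k)"
proof -
  obtain a d where g: "rrat a" "rrat d"
    "\<And>p k s. \<bar>a p (prod_encode (k, s)) - g p k\<bar> \<le> d p (prod_encode (k, s))"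
    "\<And>p k. (\<lambda>s. d p (prod_encode (k, s))) \<longlonglongrightarrow> 0"
    using assms unfolding creal_def by blast
  obtain u v w where rec: "rec1 u" "rec1 v" "rec1 w"
    and ad: "\<And>p k. a p k - d p k = (real (u p k) - real (v p k)) / (real (w p k) + 1)"
    using rrat_diff[OF g(1,2)] unfolding rrat_def by blast
  have pos: "0 < a p k - d p k \<longleftrightarrow> u p k - v p k \<noteq> 0" for p k
    unfolding ad by (auto simp: zero_less_divide_iff)
  have "0 < g p k \<longleftrightarrow> (\<exists>s. u p (prod_encode (k, s)) - v p (prod_encode (k, s)) \<noteq> 0)" for p k
    unfolding pos[symmetric]
  proof
    assume "0 < g p k"
    then have "\<forall>\<^sub>F s in sequentially. d p (prod_encode (k, s)) < g p k / 2"
      using order_tendstoD(2)[OF g(4), of "g p k / 2"] by simp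
    then obtain s where "d p (prod_encode (k, s)) < g p k / 2"
      using eventually_happens by force
    then show "\<exists>s. 0 < a p (prod_encode (k, s)) - d p (prod_encode (k, s))"
      using g(3)[of p k s] by (intro exI[of _ s]) linarith
  next
    assume "\<exists>s. 0 < a p (prod_encode (k, s)) - d p (prod_encode (k, s))"
    then obtain s where "0 < a p (prod_encode (k, s)) - d p (prod_encode (k, s))" ..
    then show "0 < g p k" using g(3)[of p k s] by linarith
  qed
  then show ?thesis unfolding semidec_def using rec1_diff[OF rec(1,2)] by blast
qed

text \<open>Dovetailing: an output position is read as a candidate with a stage. If the test fails
  at that stage the output is 0, which \<open>ball_code\<close> decodes to the empty set, so the
  output is total even when nothing is ever accepted.\<close>

lemma theta_name_semidec:
  assumes "semidec Q" "rec1 out"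
  shows "\<exists>e. \<forall>p. \<exists>q. machine_out e p q \<and> theta_name m q (\<Union>k\<in>{k. Q p k}. ball_code m (out p k))"
proof -
  obtain t where t: "rec1 t" "\<And>p k. Q p k \<longleftrightarrow> (\<exists>s. t p (prod_encode (k, s)) \<noteq> 0)"
    using assms(1) unfolding semidec_def by blast
  define q where "q p k = (if t p k = 0 then 0 else out p (fst (prod_decode k)))" for p k
  have "rec1 q" unfolding q_def
    by (intro rec1_if t rec1_const rec1_subst[OF assms(2)] rec1_fst rec1_id)
  then obtain e where e: "\<And>p k. reval p e [k] (q p k)" unfolding rec1_def by blast
  show ?thesis
  proof (intro exI[of _ e] allI, intro exI conjI)
    fix p
    show "machine_out e p (q p)" unfolding machine_out_def using e by blast
    have "(\<Union>k. ball_code m (q p k)) = (\<Union>k\<in>{k. Q p k}. ball_code m (out p k))"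
    proof (intro equalityI subsetI)
      fix x assume "x \<in> (\<Union>k. ball_code m (q p k))"
      then obtain k where k: "x \<in> ball_code m (q p k)" by blast
      then have "t p k \<noteq> 0" by (auto simp: q_def ball_code_def split: if_splits)
      moreover from this have "Q p (fst (prod_decode k))"
        unfolding t(2) by (intro exI[of _ "snd (prod_decode k)"]) simp
      ultimately show "x \<in> (\<Union>k\<in>{k. Q p k}. ball_code m (out p k))"
        using k by (auto simp: q_def)
    next
      fix x assume "x \<in> (\<Union>k\<in>{k. Q p k}. ball_code m (out p k))"
      then obtain k s where "t p (prod_encode (k, s)) \<noteq> 0" "x \<in> ball_code m (out p k)"
        using t(2) by auto
      then show "x \<in> (\<Union>k. ball_code m (q p k))"
        by (intro UN_I[of "prod_encode (k, s)"]) (auto simp: q_def)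
    qed
    then show "theta_name m (q p) (\<Union>k\<in>{k. Q p k}. ball_code m (out p k))"
      unfolding theta_name_def by simp
  qed
qed

section \<open>Quantifier elimination\<close>

text \<open>The leading coefficient may vanish at some parameters, so a family carries a uniform
  bound on the degree instead of a degree.\<close>

definition polys :: "('t \<Rightarrow> real) set \<Rightarrow> nat \<Rightarrow> ('t \<Rightarrow> real poly) set" where
  "polys A n = {P. (\<forall>i. (\<lambda>t. coeff (P t) i) \<in> A) \<and> (\<forall>t. degree (P t) \<le> n)}"

lemma polysI: "(\<And>i. (\<lambda>t. coeff (P t) i) \<in> A) \<Longrightarrow> (\<And>t. degree (P t) \<le> n) \<Longrightarrow> P \<in> polys A n"
  by (simp add: polys_def)

lemma polys_coeff: "P \<in> polys A n \<Longrightarrow> (\<lambda>t. coeff (P t) i) \<in> A"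
  and polys_degree: "P \<in> polys A n \<Longrightarrow> degree (P t) \<le> n"
  by (auto simp: polys_def)

lemma poly_sum_coeff:
  fixes p :: "'a::comm_semiring_1 poly"
  assumes "degree p \<le> n" shows "poly p x = (\<Sum>i\<le>n. coeff p i * x ^ i)"
proof -
  have "(\<Sum>i\<le>degree p. coeff p i * x ^ i) = (\<Sum>i\<le>n. coeff p i * x ^ i)"
    by (rule sum.mono_neutral_left) (use assms in \<open>auto simp: coeff_eq_0\<close>)
  then show ?thesis by (simp add: poly_altdef)
qed

lemma sgn_eq_pos: "sgn a = sgn b \<Longrightarrow> 0 < a \<longleftrightarrow> 0 < b" for a b :: real
  by (auto simp: sgn_if split: if_splits)

lemma poly_sgn_eq:
  fixes p :: "real poly"
  assumes "\<And>z. min x y \<le> z \<Longrightarrow> z \<le> max x y \<Longrightarrow> poly p z \<noteq> 0"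
  shows "sgn (poly p x) = sgn (poly p y)"
proof (rule ccontr)
  assume neq: "sgn (poly p x) \<noteq> sgn (poly p y)"
  moreover have "poly p x \<noteq> 0" "poly p y \<noteq> 0" using assms[of x] assms[of y] by auto
  ultimately have prod: "poly p x * poly p y < 0"
    by (auto simp: sgn_if mult_less_0_iff split: if_splits)
  consider "x < y" | "y < x" | "x = y" by linarith
  then show False
  proof cases
    case 1
    then obtain z where "x < z" "z < y" "poly p z = 0" using poly_IVT prod by blast
    then show False using assms[of z] by auto
  next
    case 2
    then obtain z where "y < z" "z < x" "poly p z = 0"
      using poly_IVT[of y x p] prod by (auto simp: mult.commute)
    then show False using assms[of z] by auto
  qed (use neq in simp)
qed

text \<open>Here \<open>l\<close> and \<open>r\<close> are the neighbours of \<open>y\<close> in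
  \<open>L\<close>. If \<open>y\<close> is in \<open>L\<close>, both equal \<open>y\<close>;
  otherwise no root lies strictly between them. The midpoint thus represents \<open>y\<close> and
  depends on \<open>L\<close> alone.\<close>

lemma poly_sgn_midpoint:
  fixes p :: "real poly"
  assumes roots: "\<And>z. poly p z = 0 \<Longrightarrow> z \<in> L"
    and l: "l \<in> L" "l \<le> y" "\<And>g. g \<in> L \<Longrightarrow> g \<le> y \<Longrightarrow> g \<le> l"
    and r: "r \<in> L" "y \<le> r" "\<And>g. g \<in> L \<Longrightarrow> y \<le> g \<Longrightarrow> r \<le> g"
  shows "sgn (poly p ((l + r) / 2)) = sgn (poly p y)"
proof (cases "y \<in> L")
  case True
  then have "l = y" "r = y" using l r by force+
  then show ?thesis by simp
next
  case False
  then have lt: "l < y" "y < r" using l r by (force simp: less_le)+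
  show ?thesis
  proof (rule poly_sgn_eq)
    fix z assume "min ((l + r) / 2) y \<le> z" "z \<le> max ((l + r) / 2) y"
    then have "l < z" "z < r" using lt by (auto simp: min_def max_def split: if_splits)
    then have "z \<notin> L" using l(3)[of z] r(3)[of z] by linarith
    then show "poly p z \<noteq> 0" using roots by blast
  qed
qed

text \<open>A Cauchy bound with \<open>1 + c^2\<close> in place of the absolute value of a
  coefficient \<open>c\<close>: this makes it a polynomial expression, available in any ring
  containing the coefficients.\<close>

lemma root_bound:
  fixes p :: "real poly"
  assumes deg: "degree p \<le> Suc n" and monic: "coeff p (Suc n) = 1" and y: "poly p y = 0"
  shows "\<bar>y\<bar> < 1 + (\<Sum>i\<le>n. 1 + (coeff p i)\<^sup>2)"
proof (rule ccontr)
  let ?S = "\<Sum>i\<le>n. 1 + (coeff p i)\<^sup>2"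
  assume "\<not> \<bar>y\<bar> < 1 + ?S"
  moreover have S: "0 \<le> ?S" by (rule sum_nonneg) simp
  ultimately have y1: "1 \<le> \<bar>y\<bar>" "?S < \<bar>y\<bar>" by auto
  have "0 = y ^ Suc n + (\<Sum>i\<le>n. coeff p i * y ^ i)"
    using y unfolding poly_sum_coeff[OF deg] by (simp add: monic)
  then have "\<bar>y\<bar> ^ Suc n = \<bar>\<Sum>i\<le>n. coeff p i * y ^ i\<bar>"
    by (metis abs_minus_cancel add.commute add_eq_0_iff power_abs)
  also have "\<dots> \<le> (\<Sum>i\<le>n. \<bar>coeff p i * y ^ i\<bar>)" by (rule sum_abs)
  also have "\<dots> \<le> (\<Sum>i\<le>n. (1 + (coeff p i)\<^sup>2) * \<bar>y\<bar> ^ n)"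
  proof (rule sum_mono)
    fix i assume "i \<in> {..n}"
    then have "\<bar>y\<bar> ^ i \<le> \<bar>y\<bar> ^ n" using y1 by (intro power_increasing) auto
    moreover have "\<bar>coeff p i\<bar> \<le> 1 + (coeff p i)\<^sup>2"
    proof -
      have "0 \<le> (\<bar>coeff p i\<bar> - 1)\<^sup>2" by simp
      then have "2 * \<bar>coeff p i\<bar> \<le> 1 + (coeff p i)\<^sup>2" by (simp add: power2_eq_square algebra_simps)
      then show ?thesis by linarith
    qed
    ultimately show "\<bar>coeff p i * y ^ i\<bar> \<le> (1 + (coeff p i)\<^sup>2) * \<bar>y\<bar> ^ n"
      unfolding abs_mult power_abs by (intro mult_mono) auto
  qed
  also have "\<dots> = ?S * \<bar>y\<bar> ^ n" by (rule sum_distrib_right[symmetric])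
  also have "\<dots> < \<bar>y\<bar> * \<bar>y\<bar> ^ n" using y1 by (intro mult_strict_right_mono) auto
  finally show False by simp
qed

section \<open>Rings of functions with definable signs\<close>

text \<open>Points \<open>t\<close> are parameters, \<open>B\<close> consists of the definable sets
  of parameters, and \<open>A\<close> of the admissible coefficient functions. Elements of
  \<open>A\<close> are tied to \<open>B\<close> only through their signs, so \<open>A\<close> can be
  enlarged by roots while \<open>B\<close> stays fixed.\<close>

locale sign_ring =
  fixes B :: "'t set set" and A :: "('t \<Rightarrow> real) set"
  assumes UNIV_B: "UNIV \<in> B"
    and Compl_B: "S \<in> B \<Longrightarrow> - S \<in> B"
    and Int_B: "S \<in> B \<Longrightarrow> T \<in> B \<Longrightarrow> S \<inter> T \<in> B"
    and one_A: "(\<lambda>t. 1) \<in> A"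
    and uminus_A: "a \<in> A \<Longrightarrow> (\<lambda>t. - a t) \<in> A"
    and add_A: "a \<in> A \<Longrightarrow> b \<in> A \<Longrightarrow> (\<lambda>t. a t + b t) \<in> A"
    and mult_A: "a \<in> A \<Longrightarrow> b \<in> A \<Longrightarrow> (\<lambda>t. a t * b t) \<in> A"
    and pos_B: "a \<in> A \<Longrightarrow> {t. 0 < a t} \<in> B"
begin

lemma not_B: "{t. P t} \<in> B \<Longrightarrow> {t. \<not> P t} \<in> B"
  using Compl_B[of "{t. P t}"] by (simp add: Collect_neg_eq)

lemma conj_B: "{t. P t} \<in> B \<Longrightarrow> {t. Q t} \<in> B \<Longrightarrow> {t. P t \<and> Q t} \<in> B"
  using Int_B[of "{t. P t}" "{t. Q t}"] by (simp add: Collect_conj_eq)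

lemma disj_B: "{t. P t} \<in> B \<Longrightarrow> {t. Q t} \<in> B \<Longrightarrow> {t. P t \<or> Q t} \<in> B"
  using not_B[OF conj_B[OF not_B not_B], of P Q] by simp

lemma all_B: "finite G \<Longrightarrow> (\<And>g. g \<in> G \<Longrightarrow> {t. P g t} \<in> B) \<Longrightarrow> {t. \<forall>g\<in>G. P g t} \<in> B"
  by (induction rule: finite_induct) (auto simp: UNIV_B intro!: conj_B)

lemma ex_B: "finite G \<Longrightarrow> (\<And>g. g \<in> G \<Longrightarrow> {t. P g t} \<in> B) \<Longrightarrow> {t. \<exists>g\<in>G. P g t} \<in> B"
  using not_B[OF all_B[of G "\<lambda>g t. \<not> P g t"]] not_B by simp

lemma zero_A: "(\<lambda>t. 0) \<in> A"
  using add_A[OF one_A uminus_A[OF one_A]] by simp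

lemma diff_A: "a \<in> A \<Longrightarrow> b \<in> A \<Longrightarrow> (\<lambda>t. a t - b t) \<in> A"
  using add_A[OF _ uminus_A] by fastforce

lemma power_A: "a \<in> A \<Longrightarrow> (\<lambda>t. a t ^ k) \<in> A"
  by (induction k) (auto intro: one_A mult_A)

lemma prod_A: "(\<And>i. i \<in> I \<Longrightarrow> a i \<in> A) \<Longrightarrow> (\<lambda>t. \<Prod>i\<in>I. a i t) \<in> A"
  by (induction I rule: infinite_finite_induct) (auto intro: one_A mult_A)

lemma sum_A: "(\<And>i. i \<in> I \<Longrightarrow> a i \<in> A) \<Longrightarrow> (\<lambda>t. \<Sum>i\<in>I. a i t) \<in> A"
  by (induction I rule: infinite_finite_induct) (auto intro: zero_A add_A)

lemma of_nat_A: "(\<lambda>t. of_nat n) \<in> A"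
  using sum_A[of "{..<n}" "\<lambda>_ _. 1"] one_A by simp

lemma less_B: "a \<in> A \<Longrightarrow> b \<in> A \<Longrightarrow> {t. a t < b t} \<in> B"
  using pos_B[OF diff_A[of b a]] by simp

lemma eq_B: "a \<in> A \<Longrightarrow> b \<in> A \<Longrightarrow> {t. a t = b t} \<in> B"
  using conj_B[OF not_B[OF less_B[of a b]] not_B[OF less_B[of b a]]]
  by (simp add: not_less eq_iff conj_commute)

lemma polys_mono: "P \<in> polys A n \<Longrightarrow> n \<le> m \<Longrightarrow> P \<in> polys A m"
  by (auto simp: polys_def intro: order_trans)

lemma polys_const: "a \<in> A \<Longrightarrow> (\<lambda>t. [:a t:]) \<in> polys A n"
proof (rule polysI)
  show "a \<in> A \<Longrightarrow> (\<lambda>t. coeff [:a t:] i) \<in> A" for i by (cases i) (auto simp: zero_A)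
qed simp

lemma polys_monom: "a \<in> A \<Longrightarrow> (\<lambda>t. monom (a t) n) \<in> polys A n"
proof (rule polysI)
  show "a \<in> A \<Longrightarrow> (\<lambda>t. coeff (monom (a t) n) i) \<in> A" for i
    by (cases "n = i") (auto simp: zero_A)
qed (rule degree_monom_le)

lemma polys_uminus: "P \<in> polys A n \<Longrightarrow> (\<lambda>t. - P t) \<in> polys A n"
  by (rule polysI) (auto simp: polys_def intro: uminus_A)

lemma polys_add: "P \<in> polys A n \<Longrightarrow> Q \<in> polys A n \<Longrightarrow> (\<lambda>t. P t + Q t) \<in> polys A n"
  by (rule polysI) (auto simp: polys_def intro: add_A degree_add_le)

lemma polys_diff: "P \<in> polys A n \<Longrightarrow> Q \<in> polys A n \<Longrightarrow> (\<lambda>t. P t - Q t) \<in> polys A n"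
  by (rule polysI) (auto simp: polys_def intro: diff_A degree_diff_le)

lemma polys_mult:
  assumes "P \<in> polys A n" "Q \<in> polys A m" shows "(\<lambda>t. P t * Q t) \<in> polys A (n + m)"
proof (rule polysI)
  show "(\<lambda>t. coeff (P t * Q t) i) \<in> A" for i
    unfolding coeff_mult by (intro sum_A mult_A polys_coeff[OF assms(1)] polys_coeff[OF assms(2)])
  show "degree (P t * Q t) \<le> n + m" for t
    using degree_mult_le[of "P t" "Q t"] polys_degree[OF assms(1), of t] polys_degree[OF assms(2), of t]
    by linarith
qed

lemma polys_smult: "a \<in> A \<Longrightarrow> P \<in> polys A n \<Longrightarrow> (\<lambda>t. smult (a t) (P t)) \<in> polys A n"
  using polys_mult[OF polys_const[of a 0], of P n] by simp

lemma polys_pderiv: "P \<in> polys A (Suc n) \<Longrightarrow> (\<lambda>t. pderiv (P t)) \<in> polys A n"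
proof (rule polysI)
  assume P: "P \<in> polys A (Suc n)"
  show "(\<lambda>t. coeff (pderiv (P t)) i) \<in> A" for i
    unfolding coeff_pderiv by (intro mult_A of_nat_A polys_coeff[OF P])
  show "degree (pderiv (P t)) \<le> n" for t
    using polys_degree[OF P, of t] by (simp add: degree_pderiv)
qed

lemma polys_degree_less:
  assumes P: "P \<in> polys A (Suc n)" and "\<And>t. coeff (P t) (Suc n) = 0"
  shows "P \<in> polys A n"
proof (rule polysI)
  show "degree (P t) \<le> n" for t
  proof (rule degree_le, intro allI impI)
    fix i assume "n < i"
    then show "coeff (P t) i = 0"
      using assms(2)[of t] polys_degree[OF P, of t] by (cases "i = Suc n") (auto intro: coeff_eq_0)
  qed
qed (rule polys_coeff[OF P])

lemma poly_A: "P \<in> polys A n \<Longrightarrow> a \<in> A \<Longrightarrow> (\<lambda>t. poly (P t) (a t)) \<in> A"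
  by (subst poly_sum_coeff[OF polys_degree[of P A n]]) (auto intro!: sum_A mult_A power_A polys_coeff)

text \<open>Polynomial expressions in \<open>h\<close> over \<open>A\<close> inherit the ring laws
  from polynomials; the only thing at stake is their positivity sets, which the assumption
  provides.\<close>

lemma adjoin_sign_ring:
  assumes h: "\<And>n P. P \<in> polys A n \<Longrightarrow> {t. 0 < poly (P t) (h t)} \<in> B"
  shows "sign_ring B {\<lambda>t. poly (P t) (h t) | P n. P \<in> polys A n}"
proof
  let ?A = "{\<lambda>t. poly (P t) (h t) | P n. P \<in> polys A n}"
  have intro: "f \<in> ?A" if "P \<in> polys A n" "\<And>t. f t = poly (P t) (h t)" for P n f
    using that by (auto intro!: exI[of _ P])
  show "(\<lambda>t. 1) \<in> ?A" by (rule intro[OF polys_const[OF one_A, of 0]]) simp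
  show "(\<lambda>t. - a t) \<in> ?A" if a: "a \<in> ?A" for a
  proof -
    obtain P n where "a = (\<lambda>t. poly (P t) (h t))" "P \<in> polys A n" using a by blast
    then show ?thesis by (intro intro[OF polys_uminus[of P n]]) auto
  qed
  fix a b assume "a \<in> ?A" "b \<in> ?A"
  then obtain P n Q m where a: "a = (\<lambda>t. poly (P t) (h t))" "P \<in> polys A n"
    and b: "b = (\<lambda>t. poly (Q t) (h t))" "Q \<in> polys A m" by blast
  have "P \<in> polys A (n + m)" "Q \<in> polys A (n + m)" using polys_mono a b by auto
  then show "(\<lambda>t. a t + b t) \<in> ?A" using a b by (intro intro[OF polys_add[of P _ Q]]) auto
  show "(\<lambda>t. a t * b t) \<in> ?A" using a b by (intro intro[OF polys_mult[of P _ Q]]) auto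
qed (use h in \<open>auto simp: UNIV_B Compl_B Int_B\<close>)

end

section \<open>Roots of polynomials over a maximal ring\<close>

text \<open>Parameters at which \<open>P\<close> vanishes identically are exempt: there every real
  is a root, and finitely many functions cannot cover them.\<close>

definition covers_roots :: "('t \<Rightarrow> real) set \<Rightarrow> ('t \<Rightarrow> real poly) \<Rightarrow> bool" where
  "covers_roots G P \<longleftrightarrow> (\<forall>t y. P t \<noteq> 0 \<and> poly (P t) y = 0 \<longrightarrow> (\<exists>g\<in>G. g t = y))"

lemma covers_rootsD: "covers_roots G P \<Longrightarrow> P t \<noteq> 0 \<Longrightarrow> poly (P t) y = 0 \<Longrightarrow> y \<in> (\<lambda>g. g t) ` G"
  by (auto simp: covers_roots_def)

text \<open>Maximality makes the ring closed under every function \<open>h\<close> whose polynomial expressions have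
  positivity sets in the Boolean algebra, in particular under inverses (with \<open>1 / 0 = 0\<close>) and under
  isolated roots of polynomials over the ring.\<close>
locale max_sign_ring = sign_ring +
  assumes maximal: "sign_ring B A' \<Longrightarrow> A \<subseteq> A' \<Longrightarrow> A' = A"
begin

lemma definable_A:
  assumes h: "\<And>n P. P \<in> polys A n \<Longrightarrow> {t. 0 < poly (P t) (h t)} \<in> B"
  shows "h \<in> A"
proof -
  let ?A = "{\<lambda>t. poly (P t) (h t) | P n. P \<in> polys A n}"
  have "sign_ring B ?A" by (rule adjoin_sign_ring[OF h])
  moreover have "A \<subseteq> ?A"
  proof
    fix a assume "a \<in> A"
    then show "a \<in> ?A" using polys_const[of a 0] by (auto intro!: exI[of _ "\<lambda>t. [:a t:]"])
  qed
  ultimately have "?A = A" by (rule maximal)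
  moreover have "h \<in> ?A"
    using polys_monom[OF one_A, of 1] by (auto intro!: exI[of _ "\<lambda>t. monom 1 1"] simp: poly_monom)
  ultimately show ?thesis by simp
qed

lemma inverse_A:
  assumes a: "a \<in> A" shows "(\<lambda>t. inverse (a t)) \<in> A"
proof (rule definable_A)
  fix n P assume P: "P \<in> polys A n"
  \<comment> \<open>One factor \<open>a ^ n\<close> clears the denominators of the value at
    \<open>1 / a\<close>; the second turns the multiplier into a square, so the sign is unchanged.
    Where \<open>a\<close> vanishes, the value of \<open>inverse\<close> is 0 and \<open>P\<close>
    is evaluated at 0.\<close>
  define b where "b t = a t ^ n * (\<Sum>i\<le>n. coeff (P t) i * a t ^ (n - i))" for t
  have "b t = (a t ^ n)\<^sup>2 * poly (P t) (inverse (a t))" if "a t \<noteq> 0" for t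
  proof -
    have "a t ^ (n - i) = a t ^ n * inverse (a t) ^ i" if "i \<le> n" for i
      using \<open>a t \<noteq> 0\<close> that by (simp add: power_diff power_inverse divide_inverse)
    then have "(\<Sum>i\<le>n. coeff (P t) i * a t ^ (n - i)) = a t ^ n * poly (P t) (inverse (a t))"
      unfolding poly_sum_coeff[OF polys_degree[OF P]] sum_distrib_left
      by (intro sum.cong) auto
    then show ?thesis by (simp add: b_def power2_eq_square)
  qed
  then have "0 < poly (P t) (inverse (a t)) \<longleftrightarrow> 0 < b t" if "a t \<noteq> 0" for t
    using that by (simp add: zero_less_mult_iff)
  then have "0 < poly (P t) (inverse (a t))
      \<longleftrightarrow> a t = 0 \<and> 0 < poly (P t) 0 \<or> \<not> a t = 0 \<and> 0 < b t" for t
    by (cases "a t = 0") auto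
  then have "{t. 0 < poly (P t) (inverse (a t))}
      = {t. a t = 0 \<and> 0 < poly (P t) 0 \<or> \<not> a t = 0 \<and> 0 < b t}" by simp
  moreover have "b \<in> A" unfolding b_def by (intro mult_A power_A sum_A a polys_coeff[OF P])
  ultimately show "{t. 0 < poly (P t) (inverse (a t))} \<in> B"
    by (simp only:) (intro disj_B conj_B not_B eq_B pos_B poly_A[OF P] zero_A a)
qed

lemma midpoint_A: "a \<in> A \<Longrightarrow> b \<in> A \<Longrightarrow> (\<lambda>t. (a t + b t) / 2) \<in> A"
  using mult_A[OF inverse_A[OF of_nat_A[of 2]] add_A[of a b]] by (simp add: field_simps)

text \<open>Division with remainder for all parameters at once. Since the divisor is monic, removing
  a top coefficient needs neither a quotient in \<open>A\<close> nor a case distinction on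
  \<open>t\<close>.\<close>

lemma reduce_mod_monic:
  assumes P: "P \<in> polys A (Suc n)" and monic: "\<And>t. coeff (P t) (Suc n) = 1"
    and Q: "Q \<in> polys A N"
  shows "\<exists>R\<in>polys A n. \<forall>t y. poly (P t) y = 0 \<longrightarrow> poly (R t) y = poly (Q t) y"
  using Q
proof (induction N arbitrary: Q)
  case 0
  then show ?case using polys_mono by blast
next
  case (Suc N)
  show ?case
  proof (cases "Suc N \<le> n")
    case True
    then show ?thesis using Suc.prems polys_mono by blast
  next
    case False
    define k where "k = N - n"
    have k: "N = k + n" using False by (simp add: k_def)
    define D where "D t = monom (coeff (Q t) (Suc N)) k * P t" for t
    have D: "D \<in> polys A (Suc N)"
      unfolding D_def k using polys_mult[OF polys_monom[OF polys_coeff[OF Suc.prems]] P] by simp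
    have "coeff (D t) (Suc N) = coeff (Q t) (Suc N)" for t
      by (simp add: D_def coeff_monom_mult k monic)
    then have "(\<lambda>t. Q t - D t) \<in> polys A N"
      by (intro polys_degree_less[OF polys_diff[OF Suc.prems D]]) simp
    from Suc.IH[OF this] show ?thesis by (auto simp: D_def)
  qed
qed

text \<open>The sign of \<open>Q\<close> at the root \<open>h\<close> of the monic \<open>P\<close> is that of the remainder \<open>R\<close> of \<open>Q\<close> modulo
  \<open>P\<close>. The roots of \<open>R\<close> are known by induction on the degree, and the sign change of \<open>P\<close> at \<open>h\<close>
  locates \<open>h\<close> among them.\<close>
lemma isolated_root_A:
  assumes cover: "\<And>R. R \<in> polys A n \<Longrightarrow> \<exists>G. finite G \<and> G \<subseteq> A \<and> covers_roots G R"
    and P: "P \<in> polys A (Suc n)" and monic: "\<And>t. coeff (P t) (Suc n) = 1"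
    and u: "u \<in> A" and v: "v \<in> A" and C: "{t. C t} \<in> B"
    and root: "\<And>t. C t \<Longrightarrow> u t < h t \<and> h t < v t \<and> poly (P t) (h t) = 0"
    and unique: "\<And>t y. C t \<Longrightarrow> u t < y \<Longrightarrow> y < v t \<Longrightarrow> poly (P t) y = 0 \<Longrightarrow> y = h t"
    and change: "\<And>t. C t \<Longrightarrow> poly (P t) (u t) * poly (P t) (v t) < 0"
    and default: "\<And>t. \<not> C t \<Longrightarrow> h t = 0"
  shows "h \<in> A"
proof (rule definable_A)
  \<comment> \<open>Between \<open>u\<close> and \<open>v\<close> the only root is \<open>h\<close>,
    and \<open>P\<close> has opposite signs at the two ends. So \<open>g\<close> lies left of
    \<open>h\<close> iff \<open>P\<close> has the same sign at \<open>g\<close> as at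
    \<open>u\<close>: comparison with \<open>h\<close> needs only signs in \<open>A\<close>.\<close>
  have less_h: "g t < h t \<longleftrightarrow> g t \<le> u t \<or> g t < v t \<and> 0 < poly (P t) (g t) * poly (P t) (u t)"
    if t: "C t" for g t
  proof (cases "u t < g t \<and> g t < v t")
    case True
    have nz: "poly (P t) (u t) \<noteq> 0" using change[OF t] by auto
    consider "g t < h t" | "g t = h t" | "h t < g t" by linarith
    then have "g t < h t \<longleftrightarrow> 0 < poly (P t) (g t) * poly (P t) (u t)"
    proof cases
      case 1
      have "poly (P t) (g t) \<noteq> 0" using unique[OF t, of "g t"] True 1 by auto
      moreover have "\<not> poly (P t) (u t) * poly (P t) (g t) < 0"
      proof
        assume "poly (P t) (u t) * poly (P t) (g t) < 0"
        then obtain y where "u t < y" "y < g t" "poly (P t) y = 0" using poly_IVT True by blast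
        then show False using unique[OF t, of y] True 1 by auto
      qed
      ultimately show ?thesis using 1 nz by (auto simp: mult.commute not_less less_le)
    next
      case 2
      then show ?thesis using root[OF t] by simp
    next
      case 3
      have "\<not> poly (P t) (g t) * poly (P t) (v t) < 0"
      proof
        assume "poly (P t) (g t) * poly (P t) (v t) < 0"
        then obtain y where "g t < y" "y < v t" "poly (P t) y = 0" using poly_IVT True by blast
        then show False using unique[OF t, of y] True 3 by auto
      qed
      then show ?thesis using 3 change[OF t]
        by (auto simp: zero_less_mult_iff mult_less_0_iff not_less)
    qed
    then show ?thesis using True by auto
  next
    case False
    then show ?thesis using root[OF t] by auto
  qed
  have less_h_B: "{t. C t \<and> g t < h t} \<in> B" if g: "g \<in> A" for g
  proof -
    have "{t. C t \<and> g t < h t}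
        = {t. C t \<and> (\<not> u t < g t \<or> g t < v t \<and> 0 < poly (P t) (g t) * poly (P t) (u t))}"
      using less_h by (auto simp: not_less)
    then show ?thesis
      by (simp only:) (intro conj_B disj_B not_B less_B pos_B mult_A poly_A[OF P] C u v g)
  qed
  have h_less_B: "{t. C t \<and> h t < g t} \<in> B" if g: "g \<in> A" for g
  proof -
    have "h t < g t \<longleftrightarrow> \<not> g t < h t \<and> \<not> (u t < g t \<and> g t < v t \<and> poly (P t) (g t) = 0)"
      if "C t" for t
      using root[OF that] unique[OF that, of "g t"] by (cases "g t = h t") auto
    then have "{t. C t \<and> h t < g t} = {t. C t \<and> \<not> (C t \<and> g t < h t)
        \<and> \<not> (u t < g t \<and> g t < v t \<and> poly (P t) (g t) = 0)}" by auto
    then show ?thesis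
      by (simp only:) (intro conj_B disj_B not_B less_B eq_B poly_A[OF P] zero_A C u v g less_h_B)
  qed
  fix N Q assume Q: "Q \<in> polys A N"
  obtain R where R: "R \<in> polys A n"
    and RQ: "\<And>t y. poly (P t) y = 0 \<Longrightarrow> poly (R t) y = poly (Q t) y"
    using reduce_mod_monic[OF P monic Q] by blast
  obtain G where G: "finite G" "G \<subseteq> A" "covers_roots G R" using cover[OF R] by blast
  \<comment> \<open>With \<open>u\<close> and \<open>v\<close> included, \<open>h t\<close> has a
    neighbour in \<open>L\<close> on either side whenever \<open>C t\<close> holds.\<close>
  define L where "L = insert u (insert v G)"
  have L: "finite L" "\<And>g. g \<in> L \<Longrightarrow> g \<in> A" using G u v by (auto simp: L_def)
  \<comment> \<open>On \<open>C\<close>, this makes \<open>l\<close> and \<open>r\<close> the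
    nearest elements of \<open>L\<close> weakly below and above \<open>h\<close>. It is phrased
    through the comparisons just shown to lie in \<open>B\<close>.\<close>
  define nb where "nb t l r \<longleftrightarrow> \<not> (C t \<and> h t < l t) \<and> \<not> (C t \<and> r t < h t)
      \<and> (\<forall>g\<in>L. \<not> (l t < g t \<and> \<not> (C t \<and> h t < g t)))
      \<and> (\<forall>g\<in>L. \<not> (g t < r t \<and> \<not> (C t \<and> g t < h t)))" for t l r
  have nb_B: "{t. nb t l r} \<in> B" if "l \<in> L" "r \<in> L" for l r
    unfolding nb_def using that L by (intro conj_B not_B all_B less_B less_h_B h_less_B) auto
  have sgn_R: "sgn (poly (R t) ((l t + r t) / 2)) = sgn (poly (Q t) (h t))"
    if t: "C t" and lr: "l \<in> L" "r \<in> L" "nb t l r" for t l r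
  proof -
    have "sgn (poly (R t) ((l t + r t) / 2)) = sgn (poly (R t) (h t))"
    proof (cases "R t = 0")
      case False
      show ?thesis
      proof (rule poly_sgn_midpoint[where L = "(\<lambda>g. g t) ` L"])
        show "z \<in> (\<lambda>g. g t) ` L" if "poly (R t) z = 0" for z
          using covers_rootsD[OF G(3) False that] by (auto simp: L_def)
      qed (use lr t in \<open>force simp: nb_def not_less\<close>)+
    qed simp
    then show ?thesis using RQ root[OF t] by simp
  qed
  have ex_nb: "\<exists>l\<in>L. \<exists>r\<in>L. nb t l r" if t: "C t" for t
  proof -
    let ?lo = "{g t | g. g \<in> L \<and> g t \<le> h t}" and ?hi = "{g t | g. g \<in> L \<and> h t \<le> g t}"
    have fin: "finite ?lo" "finite ?hi" using L by auto
    have "u t \<in> ?lo" "v t \<in> ?hi" using root[OF t] by (auto simp: L_def intro: less_imp_le)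
    then have "Max ?lo \<in> ?lo" "Min ?hi \<in> ?hi"
      using Max_in[OF fin(1)] Min_in[OF fin(2)] by blast+
    then obtain l r where l: "l \<in> L" "l t = Max ?lo" "l t \<le> h t"
      and r: "r \<in> L" "r t = Min ?hi" "h t \<le> r t" by auto
    have "g t \<le> l t" if "g \<in> L" "g t \<le> h t" for g
      unfolding l using that by (intro Max_ge fin) auto
    moreover have "r t \<le> g t" if "g \<in> L" "h t \<le> g t" for g
      unfolding r using that by (intro Min_le fin) auto
    ultimately have "nb t l r" using t l r unfolding nb_def by (auto simp: not_less)
    then show ?thesis using l r by blast
  qed
  \<comment> \<open>Off \<open>C\<close> the default value 0 of \<open>h\<close> is inserted; on
    \<open>C\<close> the midpoint, an element of \<open>A\<close>, stands in for
    \<open>h\<close>.\<close>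
  have "{t. 0 < poly (Q t) (h t)} = {t. \<not> C t \<and> 0 < poly (Q t) 0 \<or>
      C t \<and> (\<exists>l\<in>L. \<exists>r\<in>L. nb t l r \<and> 0 < poly (R t) ((l t + r t) / 2))}"
  proof (intro Collect_cong)
    fix t
    show "0 < poly (Q t) (h t) \<longleftrightarrow> \<not> C t \<and> 0 < poly (Q t) 0 \<or>
      C t \<and> (\<exists>l\<in>L. \<exists>r\<in>L. nb t l r \<and> 0 < poly (R t) ((l t + r t) / 2))"
    proof (cases "C t")
      case True
      have "0 < poly (R t) ((l t + r t) / 2) \<longleftrightarrow> 0 < poly (Q t) (h t)"
        if "l \<in> L" "r \<in> L" "nb t l r" for l r
        using sgn_R[OF True that] by (rule sgn_eq_pos)
      then show ?thesis using ex_nb[OF True] True by blast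
    qed (simp add: default)
  qed
  moreover have "{t. \<not> C t \<and> 0 < poly (Q t) 0 \<or>
      C t \<and> (\<exists>l\<in>L. \<exists>r\<in>L. nb t l r \<and> 0 < poly (R t) ((l t + r t) / 2))} \<in> B"
    by (intro disj_B conj_B not_B C ex_B L nb_B pos_B poly_A[OF Q] poly_A[OF R] zero_A midpoint_A)
  ultimately show "{t. 0 < poly (Q t) (h t)} \<in> B" by simp
qed

text \<open>The derivative has smaller degree, so its roots are covered. Together with the bounds
  \<open>M\<close> and \<open>- M\<close> they cut the line into intervals on which \<open>P\<close>
  is monotone. A root of \<open>P\<close> is a value of \<open>G\<close> or the unique root, with a
  change of sign, between adjacent values of \<open>G\<close>; in the latter case
  \<open>isolated_root_A\<close> applies.\<close>

lemma monic_roots_covered: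
  assumes cover: "\<And>R. R \<in> polys A n \<Longrightarrow> \<exists>G. finite G \<and> G \<subseteq> A \<and> covers_roots G R"
    and P: "P \<in> polys A (Suc n)" and monic: "\<And>t. coeff (P t) (Suc n) = 1"
  shows "\<exists>G. finite G \<and> G \<subseteq> A \<and> covers_roots G P"
proof -
  obtain G1 where G1: "finite G1" "G1 \<subseteq> A" "covers_roots G1 (\<lambda>t. pderiv (P t))"
    using cover[OF polys_pderiv[OF P]] by blast
  have deriv_nz: "pderiv (P t) \<noteq> 0" for t
  proof
    assume "pderiv (P t) = 0"
    then have "coeff (pderiv (P t)) n = 0" by simp
    then show False using monic[of t] by (simp add: coeff_pderiv)
  qed
  define M where "M t = 1 + (\<Sum>i\<le>n. 1 + (coeff (P t) i)\<^sup>2)" for t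
  have M: "M \<in> A" unfolding M_def by (intro add_A one_A sum_A power_A polys_coeff[OF P])
  have bound: "- M t < y" "y < M t" if "poly (P t) y = 0" for t y
    using root_bound[OF polys_degree[OF P] monic that] unfolding M_def by (auto simp: abs_less_iff)
  define G where "G = insert M (insert (\<lambda>t. - M t) G1)"
  have G: "finite G" "G \<subseteq> A" "\<And>g. g \<in> G \<Longrightarrow> g \<in> A"
    using G1 M uminus_A by (auto simp: G_def)
  define C where "C u v t \<longleftrightarrow> u t < v t \<and> (\<forall>g\<in>G. \<not> (u t < g t \<and> g t < v t))
      \<and> poly (P t) (u t) * poly (P t) (v t) < 0" for u v t
  \<comment> \<open>Rolle's argument: two roots would enclose a zero of the derivative, hence a
    value of \<open>G1\<close>, between adjacent values of \<open>G\<close>.\<close>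
  have unique: "x = y" if "C u v t" "u t < x" "x < v t" "poly (P t) x = 0"
    "u t < y" "y < v t" "poly (P t) y = 0" for u v t x y
  proof -
    have "\<not> (a < b)" if ab: "u t < a" "b < v t" "poly (P t) a = 0" "poly (P t) b = 0" for a b
    proof
      assume "a < b"
      then obtain z where z: "a < z" "z < b" "poly (P t) b - poly (P t) a = (b - a) * poly (pderiv (P t)) z"
        using poly_MVT by blast
      then have "poly (pderiv (P t)) z = 0" using ab \<open>a < b\<close> by simp
      from covers_rootsD[OF G1(3) deriv_nz this] obtain g where "g \<in> G" "g t = z"
        by (auto simp: G_def)
      then show False using \<open>C u v t\<close> z ab unfolding C_def by force
    qed
    then show ?thesis using that by (meson linorder_neqE)
  qed
  define h where "h u v t = (if C u v t then THE y. u t < y \<and> y < v t \<and> poly (P t) y = 0 else 0)" for u v t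
  have h: "u t < h u v t \<and> h u v t < v t \<and> poly (P t) (h u v t) = 0" if "C u v t" for u v t
  proof -
    obtain y where y: "u t < y" "y < v t" "poly (P t) y = 0"
      using \<open>C u v t\<close> poly_IVT[of "u t" "v t" "P t"] unfolding C_def by blast
    then have "(THE y. u t < y \<and> y < v t \<and> poly (P t) y = 0) = y"
      using unique[OF that] by (intro the_equality) blast+
    then show ?thesis using y that by (simp add: h_def)
  qed
  have "h u v \<in> A" if uv: "u \<in> G" "v \<in> G" for u v
  proof (rule isolated_root_A[OF cover P monic])
    show "{t. C u v t} \<in> B"
    proof -
      have "{t. C u v t} = {t. u t < v t \<and> (\<forall>g\<in>G. \<not> (u t < g t \<and> g t < v t))
          \<and> 0 < - (poly (P t) (u t) * poly (P t) (v t))}" by (simp add: C_def)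
      then show ?thesis
        by (simp only:) (intro conj_B all_B not_B less_B pos_B uminus_A mult_A poly_A[OF P] G uv)
    qed
    show "u \<in> A" "v \<in> A" using uv G by auto
    show "y = h u v t" if "C u v t" "u t < y" "y < v t" "poly (P t) y = 0" for t y
      using unique[OF that] h[OF that(1)] by simp
    show "poly (P t) (u t) * poly (P t) (v t) < 0" if "C u v t" for t
      using that by (simp add: C_def)
    show "h u v t = 0" if "\<not> C u v t" for t using that by (simp add: h_def)
    show "u t < h u v t \<and> h u v t < v t \<and> poly (P t) (h u v t) = 0" if "C u v t" for t
      using that by (rule h)
  qed
  then have "(\<lambda>(u, v). h u v) ` (G \<times> G) \<subseteq> A" by auto
  moreover have "covers_roots (G \<union> (\<lambda>(u, v). h u v) ` (G \<times> G)) P"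
    unfolding covers_roots_def
  proof (intro allI impI)
    fix t y assume "P t \<noteq> 0 \<and> poly (P t) y = 0"
    then have y: "poly (P t) y = 0" ..
    show "\<exists>g\<in>G \<union> (\<lambda>(u, v). h u v) ` (G \<times> G). g t = y"
    proof (cases "\<exists>g\<in>G. g t = y")
      case False
      let ?lo = "{g t | g. g \<in> G \<and> g t < y}" and ?hi = "{g t | g. g \<in> G \<and> y < g t}"
      have fin: "finite ?lo" "finite ?hi" using G by auto
      have "- M t \<in> ?lo" "M t \<in> ?hi" using bound[OF y] by (auto simp: G_def)
      then have "Max ?lo \<in> ?lo" "Min ?hi \<in> ?hi"
        using Max_in[OF fin(1)] Min_in[OF fin(2)] by blast+
      then obtain u v where u: "u \<in> G" "u t = Max ?lo" "u t < y"
        and v: "v \<in> G" "v t = Min ?hi" "y < v t" by auto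
      have lo: "g t \<le> u t" if "g \<in> G" "g t < y" for g
        unfolding u using that by (intro Max_ge fin) auto
      have hi: "v t \<le> g t" if "g \<in> G" "y < g t" for g
        unfolding v using that by (intro Min_le fin) auto
      have gap: "\<not> (u t < g t \<and> g t < v t)" if "g \<in> G" for g
        using lo[OF that] hi[OF that] that False by force
      have "C u v t"
      proof -
        \<comment> \<open>The derivative keeps its sign between \<open>u t\<close> and
          \<open>v t\<close>. The mean value theorem on both sides of the root \<open>y\<close> then
          gives opposite signs at the ends.\<close>
        have nz: "poly (pderiv (P t)) z \<noteq> 0" if "u t < z" "z < v t" for z
          using covers_rootsD[OF G1(3) deriv_nz, of t z] gap that by (force simp: G_def)
        obtain a where a: "u t < a" "a < y" "poly (P t) y - poly (P t) (u t) = (y - u t) * poly (pderiv (P t)) a"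
          using poly_MVT u by blast
        obtain b where b: "y < b" "b < v t" "poly (P t) (v t) - poly (P t) y = (v t - y) * poly (pderiv (P t)) b"
          using poly_MVT v by blast
        have "sgn (poly (pderiv (P t)) a) = sgn (poly (pderiv (P t)) b)"
          by (rule poly_sgn_eq) (use a b nz in auto)
        moreover have "poly (pderiv (P t)) a \<noteq> 0" using nz a b by auto
        ultimately have "0 < poly (pderiv (P t)) a * poly (pderiv (P t)) b"
          by (auto simp: sgn_if zero_less_mult_iff split: if_splits)
        moreover have "poly (P t) (u t) * poly (P t) (v t)
            = - (((y - u t) * (v t - y)) * (poly (pderiv (P t)) a * poly (pderiv (P t)) b))"
        proof -
          have "poly (P t) (u t) = - ((y - u t) * poly (pderiv (P t)) a)"
            "poly (P t) (v t) = (v t - y) * poly (pderiv (P t)) b" using a(3) b(3) y by linarith+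
          then show ?thesis by (simp add: mult_ac)
        qed
        ultimately have "poly (P t) (u t) * poly (P t) (v t) < 0"
          using u v by simp
        then show ?thesis unfolding C_def using u v gap by auto
      qed
      then have "h u v t = y" using unique[of u v t "h u v t" y] h[of u v t] u v y by auto
      then show ?thesis using u v by force
    qed auto
  qed
  ultimately show ?thesis using G by (intro exI[of _ "G \<union> (\<lambda>(u, v). h u v) ` (G \<times> G)"]) auto
qed

text \<open>Where the top coefficient vanishes, \<open>P\<close> agrees with \<open>P0\<close>,
  which has a smaller degree bound; elsewhere its roots are those of \<open>P1\<close>. Because
  \<open>inverse 0 = 0\<close>, the family \<open>P1\<close> is monic at every parameter, so both
  covers are obtained globally and then united.\<close>

lemma roots_covered: "P \<in> polys A n \<Longrightarrow> \<exists>G. finite G \<and> G \<subseteq> A \<and> covers_roots G P"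
proof (induction n arbitrary: P)
  case 0
  have "covers_roots {} P"
    unfolding covers_roots_def
  proof (intro allI impI)
    fix t y assume "P t \<noteq> 0 \<and> poly (P t) y = 0"
    moreover obtain c where "P t = [:c:]"
      using polys_degree[OF 0, of t] degree_eq_zeroE[of "P t"] by blast
    ultimately show "\<exists>g\<in>{}. g t = y" by simp
  qed
  then show ?case by (intro exI[of _ "{}"]) simp
next
  case (Suc n)
  let ?a = "\<lambda>t. coeff (P t) (Suc n)"
  define P0 where "P0 t = P t - monom (?a t) (Suc n)" for t
  have a: "?a \<in> A" by (rule polys_coeff[OF Suc.prems])
  have P0: "P0 \<in> polys A n"
    unfolding P0_def by (rule polys_degree_less[OF polys_diff[OF Suc.prems polys_monom[OF a]]]) simp
  define P1 where "P1 t = monom 1 (Suc n) + smult (inverse (?a t)) (P0 t)" for t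
  have P1: "P1 \<in> polys A (Suc n)"
    unfolding P1_def
    by (intro polys_add polys_monom one_A polys_smult inverse_A a polys_mono[OF P0]) simp
  have monic: "coeff (P1 t) (Suc n) = 1" for t
    using polys_degree[OF P0, of t] by (simp add: P1_def coeff_eq_0)
  obtain G0 where G0: "finite G0" "G0 \<subseteq> A" "covers_roots G0 P0" using Suc.IH[OF P0] by blast
  obtain G1 where G1: "finite G1" "G1 \<subseteq> A" "covers_roots G1 P1"
    using monic_roots_covered[OF Suc.IH P1 monic] by blast
  have "covers_roots (G0 \<union> G1) P"
    unfolding covers_roots_def
  proof (intro allI impI)
    fix t y assume y: "P t \<noteq> 0 \<and> poly (P t) y = 0"
    show "\<exists>g\<in>G0 \<union> G1. g t = y"
    proof (cases "?a t = 0")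
      case True
      then have "P0 t = P t" by (simp add: P0_def)
      then show ?thesis using covers_rootsD[OF G0(3), of t y] y by auto
    next
      case False
      then have "P1 t = smult (inverse (?a t)) (P t)"
        by (simp add: P1_def P0_def smult_diff_right smult_monom)
      then show ?thesis using covers_rootsD[OF G1(3), of t y] y False by auto
    qed
  qed
  then show ?case using G0 G1 by (intro exI[of _ "G0 \<union> G1"]) auto
qed

end

section \<open>Elimination of one quantifier by sample points\<close>

text \<open>The quantifier-free conditions on a new variable \<open>y\<close> with coefficients in
  \<open>A\<close>.\<close>

inductive_set cyl :: "('t \<Rightarrow> real) set \<Rightarrow> ('t \<times> real) set set" for A where
  pos: "P \<in> polys A n \<Longrightarrow> {(t, y). 0 < poly (P t) y} \<in> cyl A"
| Compl: "S \<in> cyl A \<Longrightarrow> - S \<in> cyl A"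
| Int: "S \<in> cyl A \<Longrightarrow> T \<in> cyl A \<Longrightarrow> S \<inter> T \<in> cyl A"

lemma cyl_mono:
  assumes "A \<subseteq> A'" "S \<in> cyl A" shows "S \<in> cyl A'"
  using assms(2)
proof (induction rule: cyl.induct)
  case (pos P n)
  then have "P \<in> polys A' n" using assms(1) by (auto simp: polys_def)
  then show ?case by (rule cyl.pos)
qed (auto intro: cyl.intros)

context max_sign_ring
begin

lemma cyl_section: "S \<in> cyl A \<Longrightarrow> a \<in> A \<Longrightarrow> {t. (t, a t) \<in> S} \<in> B"
proof (induction rule: cyl.induct)
  case (pos P n)
  then show ?case using pos_B[OF poly_A] by simp
next
  case (Compl S)
  then show ?case using not_B by simp
next
  case (Int S T)
  then show ?case using conj_B by simp
qed

text \<open>This is what permits sample points: a Boolean combination involves finitely many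
  polynomials and sees \<open>y\<close> only through their signs.\<close>

lemma cyl_sgn_determined:
  "S \<in> cyl A \<Longrightarrow> \<exists>F. finite F \<and> (\<forall>P\<in>F. \<exists>n. P \<in> polys A n) \<and>
     (\<forall>t y z. (\<forall>P\<in>F. sgn (poly (P t) y) = sgn (poly (P t) z)) \<longrightarrow> ((t, y) \<in> S \<longleftrightarrow> (t, z) \<in> S))"
proof (induction rule: cyl.induct)
  case (pos P n)
  show ?case
  proof (intro exI[of _ "{P}"] conjI allI impI)
    fix t y z assume "\<forall>P\<in>{P}. sgn (poly (P t) y) = sgn (poly (P t) z)"
    then show "(t, y) \<in> {(t, y). 0 < poly (P t) y} \<longleftrightarrow> (t, z) \<in> {(t, y). 0 < poly (P t) y}"
      using sgn_eq_pos[of "poly (P t) y" "poly (P t) z"] by simp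
  qed (use pos in auto)
next
  case (Int S T)
  then obtain F G where
    F: "finite F" "\<forall>P\<in>F. \<exists>n. P \<in> polys A n"
      "\<And>t y z. \<forall>P\<in>F. sgn (poly (P t) y) = sgn (poly (P t) z) \<Longrightarrow> (t, y) \<in> S \<longleftrightarrow> (t, z) \<in> S"
    and G: "finite G" "\<forall>P\<in>G. \<exists>n. P \<in> polys A n"
      "\<And>t y z. \<forall>P\<in>G. sgn (poly (P t) y) = sgn (poly (P t) z) \<Longrightarrow> (t, y) \<in> T \<longleftrightarrow> (t, z) \<in> T"
    by blast
  show ?case
  proof (intro exI[of _ "F \<union> G"] conjI allI impI)
    fix t y z assume "\<forall>P\<in>F \<union> G. sgn (poly (P t) y) = sgn (poly (P t) z)"
    then show "(t, y) \<in> S \<inter> T \<longleftrightarrow> (t, z) \<in> S \<inter> T" using F(3)[of t y z] G(3)[of t y z] by auto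
  qed (use F G in auto)
qed auto

text \<open>Any \<open>y\<close> can be moved without changing a sign in \<open>F\<close>, either to
  the midpoint of its neighbours among the covered roots or to a point beyond them all. These
  targets form a finite subset of \<open>A\<close>, so the quantifier becomes a finite
  disjunction.\<close>

lemma projection_B:
  assumes S: "S \<in> cyl A" shows "{t. \<exists>y. (t, y) \<in> S} \<in> B"
proof -
  obtain F where F: "finite F" "\<And>P. P \<in> F \<Longrightarrow> \<exists>n. P \<in> polys A n"
    and det: "\<And>t y z. \<forall>P\<in>F. sgn (poly (P t) y) = sgn (poly (P t) z) \<Longrightarrow> (t, y) \<in> S \<longleftrightarrow> (t, z) \<in> S"
    using cyl_sgn_determined[OF S] by blast
  have "\<exists>G. finite G \<and> G \<subseteq> A \<and> covers_roots G P" if "P \<in> F" for P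
    using F(2)[OF that] roots_covered by blast
  then obtain cov where cov: "\<And>P. P \<in> F \<Longrightarrow> finite (cov P) \<and> cov P \<subseteq> A \<and> covers_roots (cov P) P"
    by metis
  define G where "G = (\<Union>P\<in>F. cov P)"
  have G: "finite G" "\<And>g. g \<in> G \<Longrightarrow> g \<in> A" using F cov by (auto simp: G_def)
  have roots: "z \<in> (\<lambda>g. g t) ` G" if "P \<in> F" "P t \<noteq> 0" "poly (P t) z = 0" for P t z
    using covers_rootsD[of "cov P" P t z] cov that by (auto simp: G_def)
  \<comment> \<open>A strict bound for all elements of \<open>G\<close>, with squares again so that
    it lies in \<open>A\<close>; \<open>M\<close> and \<open>- M\<close> represent the two unbounded
    intervals.\<close>
  define M where "M t = (\<Sum>g\<in>G. 1 + (g t)\<^sup>2)" for t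
  have "M \<in> A" unfolding M_def by (intro sum_A add_A one_A power_A G)
  have M: "\<bar>g t\<bar> < M t" if "g \<in> G" for g t
  proof -
    have "0 \<le> (\<bar>g t\<bar> - 1)\<^sup>2" by simp
    then have "2 * \<bar>g t\<bar> \<le> 1 + (g t)\<^sup>2" by (simp add: power2_eq_square algebra_simps)
    moreover have "0 < 1 + (g t)\<^sup>2" by (simp add: add_pos_nonneg)
    ultimately have "\<bar>g t\<bar> < 1 + (g t)\<^sup>2" by linarith
    also have "\<dots> \<le> M t" unfolding M_def by (rule member_le_sum[OF that]) (auto simp: G)
    finally show ?thesis .
  qed
  define samples where
    "samples = {M, \<lambda>t. - M t} \<union> (\<lambda>(l, r) t. (l t + r t) / 2) ` (G \<times> G)"
  have samples: "finite samples" "\<And>a. a \<in> samples \<Longrightarrow> a \<in> A"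
    using G \<open>M \<in> A\<close> uminus_A midpoint_A by (auto simp: samples_def)
  have "\<exists>a\<in>samples. (t, a t) \<in> S" if ty: "(t, y) \<in> S" for t y
  proof -
    have "\<exists>a\<in>samples. \<forall>P\<in>F. sgn (poly (P t) (a t)) = sgn (poly (P t) y)"
    proof (cases "(\<exists>g\<in>G. g t \<le> y) \<and> (\<exists>g\<in>G. y \<le> g t)")
      case True
      let ?lo = "{g t | g. g \<in> G \<and> g t \<le> y}" and ?hi = "{g t | g. g \<in> G \<and> y \<le> g t}"
      have fin: "finite ?lo" "finite ?hi" using G by auto
      have "Max ?lo \<in> ?lo" "Min ?hi \<in> ?hi"
        using Max_in[OF fin(1)] Min_in[OF fin(2)] True by blast+
      then obtain l r where l: "l \<in> G" "l t = Max ?lo" "l t \<le> y"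
        and r: "r \<in> G" "r t = Min ?hi" "y \<le> r t" by auto
      have lo: "g t \<le> l t" if "g \<in> G" "g t \<le> y" for g
        unfolding l using that by (intro Max_ge fin) auto
      have hi: "r t \<le> g t" if "g \<in> G" "y \<le> g t" for g
        unfolding r using that by (intro Min_le fin) auto
      have "sgn (poly (P t) ((l t + r t) / 2)) = sgn (poly (P t) y)" if "P \<in> F" for P
      proof (cases "P t = 0")
        case False
        show ?thesis
          by (rule poly_sgn_midpoint[where L = "(\<lambda>g. g t) ` G"])
            (use roots[OF that False] l(1,3) r(1,3) lo hi in auto)
      qed simp
      then show ?thesis using l r by (force simp: samples_def)
    next
      case False
      \<comment> \<open>On at least one side of \<open>y\<close> there is no value of
        \<open>G\<close>, not even \<open>y\<close> itself; moving outwards on that side meets no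
        root.\<close>
      have "\<exists>a\<in>{M, \<lambda>t. - M t}. \<forall>z. min (a t) y \<le> z \<and> z \<le> max (a t) y \<longrightarrow> z \<notin> (\<lambda>g. g t) ` G"
      proof (cases "\<exists>g\<in>G. g t \<le> y")
        case True
        have "z \<noteq> g t" if "g \<in> G" "min (M t) y \<le> z" for g z
          using that True False M[of g t] by (auto simp: min_le_iff_disj)
        then show ?thesis by (intro bexI[of _ M]) auto
      next
        case False
        have "z \<noteq> g t" if "g \<in> G" "z \<le> max (- M t) y" for g z
          using that False M[of g t] by (auto simp: le_max_iff_disj)
        then show ?thesis by (intro bexI[of _ "\<lambda>t. - M t"]) auto
      qed
      then obtain a where a: "a \<in> {M, \<lambda>t. - M t}"
        "\<And>z. min (a t) y \<le> z \<Longrightarrow> z \<le> max (a t) y \<Longrightarrow> z \<notin> (\<lambda>g. g t) ` G" by blast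
      have "sgn (poly (P t) (a t)) = sgn (poly (P t) y)" if "P \<in> F" for P
      proof (cases "P t = 0")
        case False
        show ?thesis by (rule poly_sgn_eq) (use a(2) roots[OF that False] in blast)
      qed simp
      then show ?thesis using a(1) by (auto simp: samples_def)
    qed
    then show ?thesis using det ty by blast
  qed
  then have "{t. \<exists>y. (t, y) \<in> S} = {t. \<exists>a\<in>samples. (t, a t) \<in> S}" by blast
  also have "\<dots> \<in> B" by (intro ex_B samples cyl_section[OF S])
  finally show ?thesis .
qed

end

text \<open>Zorn's lemma. Two elements of the union of a chain lie in a common member, so the ring
  laws pass to the union; positivity sets concern one element at a time.\<close>

lemma (in sign_ring) ex_max_sign_ring: "\<exists>M. A \<subseteq> M \<and> max_sign_ring B M"
proof -
  let ?\<A> = "{M. A \<subseteq> M \<and> sign_ring B M}"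
  have "\<exists>M\<in>?\<A>. \<forall>X\<in>?\<A>. M \<subseteq> X \<longrightarrow> X = M"
  proof (rule subset_Zorn_nonempty)
    show "?\<A> \<noteq> {}" using sign_ring_axioms by blast
    fix \<C> assume ne: "\<C> \<noteq> {}" and chain: "subset.chain ?\<A> \<C>"
    have ring: "sign_ring B M" if "M \<in> \<C>" for M using chain that by (auto simp: subset.chain_def)
    have common: "\<exists>M\<in>\<C>. a \<in> M \<and> b \<in> M" if "a \<in> \<Union>\<C>" "b \<in> \<Union>\<C>" for a b
    proof -
      obtain M N where MN: "M \<in> \<C>" "N \<in> \<C>" "a \<in> M" "b \<in> N" using \<open>a \<in> \<Union>\<C>\<close> \<open>b \<in> \<Union>\<C>\<close> by blast
      then have "M \<subseteq> N \<or> N \<subseteq> M" using subset.chain_total[OF chain, of M N] by blast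
      then show ?thesis using MN by auto
    qed
    have "sign_ring B (\<Union>\<C>)"
    proof
      obtain M where "M \<in> \<C>" using ne by blast
      then show "(\<lambda>t. 1) \<in> \<Union>\<C>" by (intro UnionI[of M] sign_ring.one_A[OF ring])
    next
      fix a assume "a \<in> \<Union>\<C>"
      then obtain M where M: "M \<in> \<C>" "a \<in> M" by blast
      then show "(\<lambda>t. - a t) \<in> \<Union>\<C>" by (intro UnionI[of M] sign_ring.uminus_A[OF ring])
      show "{t. 0 < a t} \<in> B" using M by (intro sign_ring.pos_B[OF ring])
    next
      fix a b assume "a \<in> \<Union>\<C>" "b \<in> \<Union>\<C>"
      then obtain M where M: "M \<in> \<C>" "a \<in> M" "b \<in> M" using common by blast
      show "(\<lambda>t. a t + b t) \<in> \<Union>\<C>"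
        using M by (intro UnionI[of M] sign_ring.add_A[OF ring])
      show "(\<lambda>t. a t * b t) \<in> \<Union>\<C>"
        using M by (intro UnionI[of M] sign_ring.mult_A[OF ring])
    qed (fact UNIV_B Compl_B Int_B)+
    moreover have "A \<subseteq> \<Union>\<C>"
    proof -
      obtain M where "M \<in> \<C>" using ne by blast
      moreover from this have "A \<subseteq> M" using chain by (auto simp: subset.chain_def)
      ultimately show ?thesis by blast
    qed
    ultimately show "\<Union>\<C> \<in> ?\<A>" by blast
  qed
  then obtain M where M: "M \<in> ?\<A>" and max: "\<forall>X\<in>?\<A>. M \<subseteq> X \<longrightarrow> X = M" by (rule bexE)
  have "max_sign_ring B M"
  proof (intro max_sign_ring.intro max_sign_ring_axioms.intro)
    show "sign_ring B M" using M by simp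
    fix A' assume "sign_ring B A'" "M \<subseteq> A'"
    then show "A' = M" using M max by auto
  qed
  then show ?thesis using M by auto
qed

text \<open>Passing to a maximal ring enlarges \<open>A\<close> but not \<open>B\<close>, so the
  adjoined roots leave no trace in the result.\<close>

theorem (in sign_ring) projection:
  assumes "S \<in> cyl A" shows "{t. \<exists>y. (t, y) \<in> S} \<in> B"
proof -
  obtain M where "A \<subseteq> M" "max_sign_ring B M" using ex_max_sign_ring by blast
  then show ?thesis using max_sign_ring.projection_B[OF _ cyl_mono[OF _ assms]] by blast
qed

section \<open>Semi-algebraic sets up to nowhere dense sets\<close>

text \<open>Generated as a ring from constants in \<open>F\<close> and the first \<open>K\<close>
  coordinates, without a normal form. So \<open>F\<close> may be any set, and computability of
  values follows by induction on the generation.\<close>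

inductive_set polyF :: "real set \<Rightarrow> nat \<Rightarrow> ((nat \<Rightarrow> real) \<Rightarrow> real) set" for F K where
  const: "c \<in> F \<Longrightarrow> (\<lambda>e. c) \<in> polyF F K"
| one: "(\<lambda>e. 1) \<in> polyF F K"
| var: "i < K \<Longrightarrow> (\<lambda>e. e i) \<in> polyF F K"
| uminus: "p \<in> polyF F K \<Longrightarrow> (\<lambda>e. - p e) \<in> polyF F K"
| add: "p \<in> polyF F K \<Longrightarrow> q \<in> polyF F K \<Longrightarrow> (\<lambda>e. p e + q e) \<in> polyF F K"
| mult: "p \<in> polyF F K \<Longrightarrow> q \<in> polyF F K \<Longrightarrow> (\<lambda>e. p e * q e) \<in> polyF F K"

inductive_set sa :: "real set \<Rightarrow> nat \<Rightarrow> (nat \<Rightarrow> real) set set" for F K where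
  pos: "p \<in> polyF F K \<Longrightarrow> {e. 0 < p e} \<in> sa F K"
| Compl: "S \<in> sa F K \<Longrightarrow> - S \<in> sa F K"
| Int: "S \<in> sa F K \<Longrightarrow> T \<in> sa F K \<Longrightarrow> S \<inter> T \<in> sa F K"

global_interpretation sa: sign_ring "sa F K" "polyF F K" for F K
proof
  show "UNIV \<in> sa F K" using sa.pos[OF polyF.one, of F K] by simp
qed (auto intro: sa.intros polyF.intros)

text \<open>The coordinate \<open>i\<close> is overwritten rather than removed, so the parameters
  are again full environments and elimination can be iterated in one space.\<close>

lemma polyF_as_poly:
  "p \<in> polyF F K \<Longrightarrow> \<exists>n. \<exists>P\<in>polys (polyF F K) n. \<forall>e y. p (e(i := y)) = poly (P e) y"
proof (induction rule: polyF.induct)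
  case (const c)
  then show ?case
    by (intro exI[of _ 0] bexI[of _ "\<lambda>e. [:c:]"] sa.polys_const polyF.const) auto
next
  case one
  show ?case by (intro exI[of _ 0] bexI[of _ "\<lambda>e. [:1:]"] sa.polys_const polyF.one) auto
next
  case (var j)
  show ?case
  proof (cases "j = i")
    case True
    then show ?thesis
      by (intro exI[of _ 1] bexI[of _ "\<lambda>e. monom 1 1"] sa.polys_monom polyF.one)
        (auto simp: poly_monom)
  next
    case False
    then show ?thesis using var
      by (intro exI[of _ 0] bexI[of _ "\<lambda>e. [:e j:]"] sa.polys_const polyF.var) auto
  qed
next
  case (uminus p)
  then obtain n P where "P \<in> polys (polyF F K) n" "\<forall>e y. p (e(i := y)) = poly (P e) y" by blast
  then show ?case
    by (intro exI[of _ n] bexI[of _ "\<lambda>e. - P e"] sa.polys_uminus) (auto simp del: fun_upd_apply)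
next
  case (add p q)
  then obtain n P m Q where P: "P \<in> polys (polyF F K) n" "\<forall>e y. p (e(i := y)) = poly (P e) y"
    and Q: "Q \<in> polys (polyF F K) m" "\<forall>e y. q (e(i := y)) = poly (Q e) y" by blast
  then show ?case
    by (intro exI[of _ "n + m"] bexI[of _ "\<lambda>e. P e + Q e"] sa.polys_add
        sa.polys_mono[OF P(1)] sa.polys_mono[OF Q(1)]) (auto simp del: fun_upd_apply)
next
  case (mult p q)
  then obtain n P m Q where P: "P \<in> polys (polyF F K) n" "\<forall>e y. p (e(i := y)) = poly (P e) y"
    and Q: "Q \<in> polys (polyF F K) m" "\<forall>e y. q (e(i := y)) = poly (Q e) y" by blast
  then show ?case
    by (intro exI[of _ "n + m"] bexI[of _ "\<lambda>e. P e * Q e"] sa.polys_mult) (auto simp del: fun_upd_apply)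
qed

lemma sa_ex_var:
  assumes "S \<in> sa F K" shows "{e. \<exists>y. e(i := y) \<in> S} \<in> sa F K"
proof -
  have "{(e, y). e(i := y) \<in> S} \<in> cyl (polyF F K)"
    using assms
  proof (induction rule: sa.induct)
    case (pos p)
    then obtain n P where P: "P \<in> polys (polyF F K) n" "\<forall>e y. p (e(i := y)) = poly (P e) y"
      using polyF_as_poly by blast
    then show ?case using cyl.pos[OF P(1)] by (simp del: fun_upd_apply)
  next
    case (Compl S)
    have "{(e, y). e(i := y) \<in> - S} = - {(e, y). e(i := y) \<in> S}" by auto
    then show ?case using cyl.Compl[OF Compl.IH] by (simp only:)
  next
    case (Int S T)
    have "{(e, y). e(i := y) \<in> S \<inter> T} = {(e, y). e(i := y) \<in> S} \<inter> {(e, y). e(i := y) \<in> T}" by auto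
    then show ?case using cyl.Int[OF Int.IH] by (simp only:)
  qed
  from sa.projection[OF this] show ?thesis by (simp del: fun_upd_apply)
qed

lemma sa_ex_block:
  assumes "finite J" "S \<in> sa F K"
  shows "{e. \<exists>e'\<in>S. \<forall>i. i \<notin> J \<longrightarrow> e' i = e i} \<in> sa F K"
  using assms(1)
proof (induction rule: finite_induct)
  case empty
  have "{e. \<exists>e'\<in>S. \<forall>i. i \<notin> {} \<longrightarrow> e' i = e i} = S" by (auto simp: fun_eq_iff[symmetric])
  then show ?case using assms(2) by simp
next
  case (insert j J)
  have "(\<exists>e'\<in>S. \<forall>i. i \<notin> insert j J \<longrightarrow> e' i = e i)
      \<longleftrightarrow> (\<exists>y. \<exists>e'\<in>S. \<forall>i. i \<notin> J \<longrightarrow> e' i = (e(j := y)) i)" for e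
  proof
    assume "\<exists>e'\<in>S. \<forall>i. i \<notin> insert j J \<longrightarrow> e' i = e i"
    then obtain e' where "e' \<in> S" "\<forall>i. i \<notin> insert j J \<longrightarrow> e' i = e i" by blast
    then show "\<exists>y. \<exists>e'\<in>S. \<forall>i. i \<notin> J \<longrightarrow> e' i = (e(j := y)) i"
      by (intro exI[of _ "e' j"] bexI[of _ e']) auto
  next
    assume "\<exists>y. \<exists>e'\<in>S. \<forall>i. i \<notin> J \<longrightarrow> e' i = (e(j := y)) i"
    then obtain y e' where "e' \<in> S" "\<forall>i. i \<notin> J \<longrightarrow> e' i = (e(j := y)) i" by blast
    then show "\<exists>e'\<in>S. \<forall>i. i \<notin> insert j J \<longrightarrow> e' i = e i" by (intro bexI[of _ e']) auto
  qed
  then show ?case using sa_ex_var[OF insert.IH, of j] by (simp del: fun_upd_apply)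
qed

lemma polyF_cong: "p \<in> polyF F K \<Longrightarrow> (\<And>i. i < K \<Longrightarrow> e i = e' i) \<Longrightarrow> p e = p e'"
  by (induction rule: polyF.induct) auto

section \<open>Strict inequalities and generic points\<close>

text \<open>Without complements, every set is open along lines, and membership of computable points
  is semi-decidable.\<close>

inductive_set sop :: "real set \<Rightarrow> nat \<Rightarrow> (nat \<Rightarrow> real) set set" for F K where
  pos: "p \<in> polyF F K \<Longrightarrow> {e. 0 < p e} \<in> sop F K"
| Int: "S \<in> sop F K \<Longrightarrow> T \<in> sop F K \<Longrightarrow> S \<inter> T \<in> sop F K"
| Un: "S \<in> sop F K \<Longrightarrow> T \<in> sop F K \<Longrightarrow> S \<union> T \<in> sop F K"

lemma sop_cong:
  assumes "S \<in> sop F K" "\<And>i. i < K \<Longrightarrow> e i = e' i" shows "e \<in> S \<longleftrightarrow> e' \<in> S"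
  using assms(1)
proof (induction rule: sop.induct)
  case (pos p)
  then show ?case using polyF_cong[OF pos assms(2)] by simp
qed auto

text \<open>Openness along lines replaces Euclidean openness: polynomials restrict to univariate
  polynomials on lines, and rational points are found by moving one coordinate at a time.\<close>
definition lopen :: "(nat \<Rightarrow> real) set \<Rightarrow> bool" where
  "lopen U \<longleftrightarrow> (\<forall>e\<in>U. \<forall>v. \<exists>d>0. \<forall>s. \<bar>s\<bar> < d \<longrightarrow> (\<lambda>i. e i + s * v i) \<in> U)"

lemma lopenD:
  assumes "lopen U" "e \<in> U"
  obtains d where "d > 0" "\<And>s. \<bar>s\<bar> < d \<Longrightarrow> (\<lambda>i. e i + s * v i) \<in> U"
  using assms unfolding lopen_def by blast

lemma lopen_Int:
  assumes "lopen U" "lopen V" shows "lopen (U \<inter> V)"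
  unfolding lopen_def
proof (intro ballI allI)
  fix e v assume e: "e \<in> U \<inter> V"
  obtain a where a: "a > 0" "\<And>s. \<bar>s\<bar> < a \<Longrightarrow> (\<lambda>i. e i + s * v i) \<in> U"
    using lopenD[OF assms(1), of e v] e by blast
  obtain b where b: "b > 0" "\<And>s. \<bar>s\<bar> < b \<Longrightarrow> (\<lambda>i. e i + s * v i) \<in> V"
    using lopenD[OF assms(2), of e v] e by blast
  show "\<exists>d>0. \<forall>s. \<bar>s\<bar> < d \<longrightarrow> (\<lambda>i. e i + s * v i) \<in> U \<inter> V"
    using a b by (intro exI[of _ "min a b"]) auto
qed

lemma lopen_Un:
  assumes "lopen U" "lopen V" shows "lopen (U \<union> V)"
  unfolding lopen_def
proof (intro ballI allI)
  fix e v assume "e \<in> U \<union> V"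
  then show "\<exists>d>0. \<forall>s. \<bar>s\<bar> < d \<longrightarrow> (\<lambda>i. e i + s * v i) \<in> U \<union> V"
  proof
    assume "e \<in> U"
    from lopenD[OF assms(1) this, of v] show ?thesis by (metis UnI1)
  next
    assume "e \<in> V"
    from lopenD[OF assms(2) this, of v] show ?thesis by (metis UnI2)
  qed
qed

lemma polyF_line: "p \<in> polyF F K \<Longrightarrow> \<exists>q. \<forall>s. p (\<lambda>i. e i + s * v i) = poly q s"
proof (induction rule: polyF.induct)
  case (const c)
  show ?case by (intro exI[of _ "[:c:]"]) simp
next
  case one
  show ?case by (intro exI[of _ "1"]) simp
next
  case (var i)
  show ?case by (intro exI[of _ "[:e i, v i:]"]) simp
qed (metis poly_minus, metis poly_add, metis poly_mult)

lemma lopen_pos: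
  assumes "p \<in> polyF F K" shows "lopen {e. 0 < p e}"
  unfolding lopen_def
proof (intro ballI allI)
  fix e v assume "e \<in> {e. 0 < p e}"
  obtain q where q: "\<And>s. p (\<lambda>i. e i + s * v i) = poly q s" using polyF_line[OF assms] by blast
  have "0 < poly q 0" using \<open>e \<in> _\<close> q[of 0] by simp
  moreover have "isCont (poly q) 0" by (rule poly_isCont)
  ultimately have "\<forall>\<^sub>F s in at 0. 0 < poly q s" unfolding isCont_def by (rule order_tendstoD(1)[rotated])
  then obtain d where "d > 0" "\<And>s. s \<noteq> 0 \<Longrightarrow> dist s 0 < d \<Longrightarrow> 0 < poly q s"
    unfolding eventually_at by auto
  then show "\<exists>d>0. \<forall>s. \<bar>s\<bar> < d \<longrightarrow> (\<lambda>i. e i + s * v i) \<in> {e. 0 < p e}"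
    using q \<open>0 < poly q 0\<close> by (intro exI[of _ d]) (auto, metis dist_0_norm dist_commute real_norm_def)
qed

lemma lopen_sop: "S \<in> sop F K \<Longrightarrow> lopen S"
  by (induction rule: sop.induct) (auto intro: lopen_pos lopen_Int lopen_Un)

text \<open>On the line from \<open>e\<close> to \<open>e'\<close> the polynomial vanishes near
  parameter 0, hence has infinitely many zeros, hence vanishes at parameter 1.\<close>

lemma polyF_zero_on_lopen:
  assumes p: "p \<in> polyF F K" and U: "lopen U" "e \<in> U" and zero: "\<And>e. e \<in> U \<Longrightarrow> p e = 0"
  shows "p e' = 0"
proof -
  let ?v = "\<lambda>i. e' i - e i"
  obtain q where q: "\<And>s. p (\<lambda>i. e i + s * ?v i) = poly q s"
    using polyF_line[OF p, of e ?v] by blast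
  obtain d where d: "d > 0" "\<And>s. \<bar>s\<bar> < d \<Longrightarrow> (\<lambda>i. e i + s * ?v i) \<in> U"
    using lopenD[OF U, of ?v] by blast
  have "{0<..<d} \<subseteq> {s. poly q s = 0}" using zero[OF d(2)] q by auto
  moreover have "infinite {0<..<d}" using d(1) by (rule infinite_Ioo)
  ultimately have "q = 0" using poly_roots_finite[of q] finite_subset by blast
  then show ?thesis using q[of 1] by simp
qed

text \<open>An inner approximation \<open>N\<close> of the complement is carried along, so that the
  complement step merely swaps \<open>P\<close> and \<open>N\<close>. For intersections the density
  of the two unions is applied in turn, as \<open>U \<inter> (P \<union> N)\<close> is again
  nonempty and open along lines.\<close>

lemma sa_generic:
  "S \<in> sa F K \<Longrightarrow> \<exists>P\<in>sop F K. \<exists>N\<in>sop F K. P \<subseteq> S \<and> N \<subseteq> - S \<and>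
     (\<forall>U. lopen U \<and> U \<noteq> {} \<longrightarrow> U \<inter> (P \<union> N) \<noteq> {})"
proof (induction rule: sa.induct)
  case (pos p)
  show ?case
  proof (cases "\<exists>e. p e \<noteq> 0")
    case True
    show ?thesis
    proof (rule bexI[of _ "{e. 0 < p e}"], rule bexI[of _ "{e. 0 < - p e}"], intro conjI allI impI)
      show "{e. 0 < p e} \<in> sop F K" "{e. 0 < - p e} \<in> sop F K"
        by (intro sop.pos polyF.uminus pos)+
      fix U assume U: "lopen U \<and> U \<noteq> {}"
      then obtain e where "e \<in> U" by blast
      then obtain e' where "e' \<in> U" "p e' \<noteq> 0"
        using polyF_zero_on_lopen[OF pos, of U e] U True by blast
      then show "U \<inter> ({e. 0 < p e} \<union> {e. 0 < - p e}) \<noteq> {}" by (auto simp: neq_iff)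
    qed auto
  next
    case False
    show ?thesis
    \<comment> \<open>If \<open>p\<close> vanishes identically, the complement is the whole space,
      written here as the solution set of \<open>0 < 1\<close>.\<close>
    proof (rule bexI[of _ "{e. 0 < p e}"], rule bexI[of _ "{e. 0 < (1::real)}"], intro conjI allI impI)
      show "{e. 0 < p e} \<in> sop F K" "{e. 0 < (1::real)} \<in> sop F K"
        by (intro sop.pos polyF.one pos)+
    qed (use False in auto)
  qed
next
  case (Compl S)
  then show ?case by (metis Un_commute double_compl)
next
  case (Int S T)
  then obtain P N P' N' where P: "P \<in> sop F K" "N \<in> sop F K" "P \<subseteq> S" "N \<subseteq> - S"
      "\<And>U. lopen U \<Longrightarrow> U \<noteq> {} \<Longrightarrow> U \<inter> (P \<union> N) \<noteq> {}"
    and P': "P' \<in> sop F K" "N' \<in> sop F K" "P' \<subseteq> T" "N' \<subseteq> - T"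
      "\<And>U. lopen U \<Longrightarrow> U \<noteq> {} \<Longrightarrow> U \<inter> (P' \<union> N') \<noteq> {}" by metis
  show ?case
  proof (rule bexI[of _ "P \<inter> P'"], rule bexI[of _ "N \<union> N'"], intro conjI allI impI)
    show "P \<inter> P' \<in> sop F K" "N \<union> N' \<in> sop F K" by (intro sop.intros P P')+
    fix U assume U: "lopen U \<and> U \<noteq> {}"
    then have "U \<inter> (P \<union> N) \<noteq> {}" by (intro P(5)) auto
    moreover have "lopen (U \<inter> (P \<union> N))"
      using U by (intro lopen_Int lopen_Un lopen_sop[OF P(1)] lopen_sop[OF P(2)]) simp
    ultimately have "U \<inter> (P \<union> N) \<inter> (P' \<union> N') \<noteq> {}" by (rule P'(5)[rotated])
    then show "U \<inter> (P \<inter> P' \<union> (N \<union> N')) \<noteq> {}" by blast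
  qed (use P P' in auto)
qed

lemma lopen_rational_point:
  assumes U: "lopen U" shows "e \<in> U \<Longrightarrow> \<exists>e'\<in>U. \<forall>i<K. e' i \<in> \<rat>"
proof (induction K)
  case (Suc K)
  then obtain e' where e': "e' \<in> U" "\<forall>i<K. e' i \<in> \<rat>" by blast
  let ?v = "\<lambda>i. if i = K then 1 else 0 :: real"
  obtain d where d: "d > 0" "\<And>s. \<bar>s\<bar> < d \<Longrightarrow> (\<lambda>i. e' i + s * ?v i) \<in> U"
    using lopenD[OF U e'(1), of ?v] by blast
  obtain r where r: "r \<in> \<rat>" "e' K < r" "r < e' K + d"
    using Rats_dense_in_real[of "e' K" "e' K + d"] d(1) by auto
  have "(\<lambda>i. e' i + (r - e' K) * ?v i) \<in> U" using r by (intro d(2)) auto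
  moreover have "\<forall>i<Suc K. e' i + (r - e' K) * ?v i \<in> \<rat>" using r e'(2) by (auto simp: less_Suc_eq)
  ultimately show ?case by (intro bexI[of _ "\<lambda>i. e' i + (r - e' K) * ?v i"])
qed auto

section \<open>Semi-decidability and translation of semi-algebraic sets\<close>

lemma creal_polyF:
  assumes "p \<in> polyF computable_reals K" and v: "\<And>i. i < K \<Longrightarrow> creal (\<lambda>q k. v q k i)"
  shows "creal (\<lambda>q k. p (v q k))"
  using assms(1)
proof (induction rule: polyF.induct)
  case (const c)
  then show ?case by (rule creal_computable_real)
next
  case one
  show ?case using creal_rrat[OF rrat_of_nat[OF rec1_const[of 1]]] by simp
next
  case (var i)
  then show ?case by (rule v)
next
  case (uminus p)
  have "creal (\<lambda>q k. - real 1)" by (intro creal_rrat rrat_minus rrat_of_nat rec1_const)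
  from creal_mult[OF this uminus.IH] show ?case by simp
qed (rule creal_add creal_mult; assumption)+

lemma semidec_sop:
  assumes "S \<in> sop computable_reals K" and v: "\<And>i. i < K \<Longrightarrow> creal (\<lambda>q k. v q k i)"
  shows "semidec (\<lambda>q k. v q k \<in> S)"
  using assms(1)
proof (induction rule: sop.induct)
  case (pos p)
  then show ?case using semidec_pos[OF creal_polyF[OF pos v]] by simp
next
  case (Int S T)
  then show ?case using semidec_conj by simp
next
  case (Un S T)
  then show ?case using semidec_disj by simp
qed

text \<open>The list \<open>I\<close> tells where the environment stores the coordinates of the
  point, so the graph of \<open>f\<close> can be read off from blocks in any order.\<close>

lemma semialg_sa:
  assumes S: "semialg F k S" and I: "length I = k" "\<And>i. i \<in> set I \<Longrightarrow> i < K"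
  shows "{e. map e I \<in> S} \<in> sa F K"
proof -
  have poly: "(\<lambda>e. peval c (map e I)) \<in> polyF F K" if c: "poly_over F k c" for c
    unfolding peval_def
  proof (intro sa.sum_A polyF.mult sa.prod_A sa.power_A polyF.const)
    fix a assume a: "a \<in> {a. c a \<noteq> 0}"
    then show "c a \<in> F" using c unfolding poly_over_def by auto
    fix i assume "i \<in> {..<length a}"
    then have "i < length I" using a c I(1) unfolding poly_over_def by auto
    then show "(\<lambda>e. map e I ! i) \<in> polyF F K" using polyF.var[of "I ! i" K F] I(2) by simp
  qed
  have basic: "{e. map e I \<in> T} \<in> sa F K" if "basic_semialg F k T" for T
  proof -
    obtain ps qs where pq: "\<And>c. c \<in> set ps \<Longrightarrow> poly_over F k c" "\<And>c. c \<in> set qs \<Longrightarrow> poly_over F k c"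
      and T: "T = {x \<in> Rn k. (\<forall>c\<in>set ps. peval c x \<ge> 0) \<and> (\<forall>c\<in>set qs. peval c x > 0)}"
      using \<open>basic_semialg F k T\<close> unfolding basic_semialg_def by blast
    have "{e. map e I \<in> T} = {e. (\<forall>c\<in>set ps. \<not> 0 < - peval c (map e I))
        \<and> (\<forall>c\<in>set qs. 0 < peval c (map e I))}"
      unfolding T using I by (auto simp: Rn_def not_less)
    then show ?thesis
      by (simp only:) (intro sa.conj_B sa.all_B sa.not_B sa.pos polyF.uminus poly pq finite_set)
  qed
  obtain L where L: "\<And>Bs T. Bs \<in> set L \<Longrightarrow> T \<in> set Bs \<Longrightarrow> basic_semialg F k T"
    and SL: "S = (\<Union>Bs\<in>set L. Rn k \<inter> \<Inter>(set Bs))"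
    using S unfolding semialg_def by blast
  have "{e. map e I \<in> S} = {e. \<exists>Bs\<in>set L. \<forall>T\<in>set Bs. map e I \<in> T}"
    unfolding SL using I by (auto simp: Rn_def)
  then show ?thesis by (simp only:) (intro sa.ex_B sa.all_B basic L finite_set; assumption)
qed

section \<open>Enumeration of balls\<close>

declare upt_Suc [simp del]

section \<open>Euclidean distance\<close>

lemma edist_L2: "edist x y = L2_set (\<lambda>i. x ! i - y ! i) {..<length x}"
  by (simp add: edist_def L2_set_def)

lemma edist_nonneg: "0 \<le> edist x y"
  by (simp add: edist_L2)

lemma edist_commute: "length x = length y \<Longrightarrow> edist x y = edist y x"
  by (simp add: edist_def power2_commute)

lemma edist_triangle:
  assumes "length x = n" "length y = n" "length z = n"
  shows "edist x z \<le> edist x y + edist y z"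
  using L2_set_triangle_ineq[of "\<lambda>i. x ! i - y ! i" "\<lambda>i. y ! i - z ! i" "{..<n}"] assms
  by (simp add: edist_L2)

text \<open>Squaring removes the root and turns a comparison of distances into polynomial
  inequalities.\<close>

lemma edist_less_iff:
  "edist x y < r \<longleftrightarrow> 0 < r \<and> (\<Sum>i<length x. (x ! i - y ! i)\<^sup>2) < r\<^sup>2"
proof (cases "0 < r")
  case True
  then show ?thesis unfolding edist_def
    using real_sqrt_less_iff[of "\<Sum>i<length x. (x ! i - y ! i)\<^sup>2" "r\<^sup>2"] by simp
next
  case False
  then show ?thesis using edist_nonneg[of x y] by linarith
qed

text \<open>The factor \<open>real n + 1\<close> is cruder than the square root of \<open>n\<close>
  but keeps the bound strict for \<open>n = 0\<close> too.\<close>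

lemma edist_coordinatewise:
  assumes "length x = n" "0 < d" "\<And>i. i < n \<Longrightarrow> \<bar>x ! i - y ! i\<bar> < d"
  shows "edist x y < (real n + 1) * d"
proof -
  have "(\<Sum>i<n. (x ! i - y ! i)\<^sup>2) \<le> (\<Sum>i<n. d\<^sup>2)"
    using assms by (intro sum_mono) (auto simp: abs_le_square_iff[symmetric] intro: less_imp_le)
  also have "\<dots> = real n * d\<^sup>2" by simp
  also have "\<dots> < (real n + 1)\<^sup>2 * d\<^sup>2"
    using assms(2) by (intro mult_strict_right_mono) (auto simp: power2_eq_square algebra_simps add_pos_nonneg)
  finally show ?thesis unfolding edist_less_iff using assms by (simp add: power_mult_distrib)
qed

lemma edist_coordinate: "i < length x \<Longrightarrow> \<bar>x ! i - y ! i\<bar> \<le> edist x y"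
  unfolding edist_L2 using member_le_L2_set[of "{..<length x}" i "\<lambda>i. x ! i - y ! i"]
    member_le_L2_set[of "{..<length x}" i "\<lambda>i. y ! i - x ! i"]
  by (auto simp: L2_set_def power2_commute abs_le_iff)

lemma open_ball_Rn:
  assumes "length c = n" shows "open_Rn n (ball_Rn n c r)"
  unfolding open_Rn_def
proof (intro conjI ballI)
  show "ball_Rn n c r \<subseteq> Rn n" by (auto simp: ball_Rn_def)
  fix x assume x: "x \<in> ball_Rn n c r"
  have "y \<in> ball_Rn n c r" if "y \<in> Rn n" "edist x y < r - edist c x" for y
    using that x edist_triangle[OF assms, of x y] by (auto simp: ball_Rn_def Rn_def)
  moreover have "0 < r - edist c x" using x by (simp add: ball_Rn_def)
  ultimately show "\<exists>d>0. \<forall>y\<in>Rn n. edist x y < d \<longrightarrow> y \<in> ball_Rn n c r" by blast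
qed

lemma sa_edist_less:
  assumes "length I = length J" "\<And>i. i \<in> set I \<Longrightarrow> i < K" "\<And>i. i \<in> set J \<Longrightarrow> i < K" "r < K"
  shows "{e. edist (map e I) (map e J) < e r} \<in> sa F K"
proof -
  have "{e. edist (map e I) (map e J) < e r}
      = {e. 0 < e r \<and> (\<Sum>i<length I. (e (I ! i) - e (J ! i))\<^sup>2) < (e r)\<^sup>2}"
    using assms(1) by (simp add: edist_less_iff)
  moreover have "\<dots> \<in> sa F K"
    using assms by (intro sa.conj_B sa.pos sa.less_B sa.sum_A sa.power_A sa.diff_A polyF.var) auto
  ultimately show ?thesis by simp
qed

section \<open>Rational balls inside the fibres of a semi-algebraic set\<close>

lemma lopen_box: "lopen {e. \<forall>i<K. \<bar>e i - c i\<bar> < b}"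
proof (induction K)
  case 0
  show ?case by (auto simp: lopen_def intro: exI[of _ 1])
next
  case (Suc K)
  \<comment> \<open>Coefficients from \<open>UNIV\<close> admit an arbitrary real box, so that
    \<open>lopen_pos\<close> applies to each face.\<close>
  have "(\<lambda>e. b - (e K - c K)) \<in> polyF UNIV (Suc K)" "(\<lambda>e. b - (c K - e K)) \<in> polyF UNIV (Suc K)"
    by (intro sa.diff_A polyF.const polyF.var; simp)+
  then have "lopen ({e. 0 < b - (e K - c K)} \<inter> {e. 0 < b - (c K - e K)})"
    by (intro lopen_Int lopen_pos)
  from lopen_Int[OF this Suc] show ?case
    by (rule back_subst[of lopen]) (auto simp: less_Suc_eq)
qed

lemma sa_interior:
  assumes "S \<in> sa F K"
  shows "\<exists>P\<in>sop F K. P \<subseteq> S \<and> (\<forall>U. lopen U \<and> U \<noteq> {} \<and> U \<subseteq> S \<longrightarrow> U \<inter> P \<noteq> {})"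
proof -
  obtain P N where P: "P \<in> sop F K" "P \<subseteq> S" "N \<subseteq> - S"
    and dense: "\<forall>U. lopen U \<and> U \<noteq> {} \<longrightarrow> U \<inter> (P \<union> N) \<noteq> {}"
    using sa_generic[OF assms] by blast
  have "U \<inter> P \<noteq> {}" if "lopen U" "U \<noteq> {}" "U \<subseteq> S" for U
  proof -
    have "U \<inter> (P \<union> N) \<noteq> {}" using dense that by simp
    then show ?thesis using P(3) that(3) by blast
  qed
  then show ?thesis using P(1,2) by (intro bexI[of _ P]) auto
qed

text \<open>Coordinates below \<open>m\<close> hold a centre, coordinate \<open>m\<close> a radius, and the following \<open>m\<close>
  coordinates a point of \<open>\<real>\<^sup>m\<close>; the remaining ones are parameters.\<close>
definition set_pt :: "nat \<Rightarrow> (nat \<Rightarrow> real) \<Rightarrow> real list \<Rightarrow> nat \<Rightarrow> real" where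
  "set_pt m e z i = (if m < i \<and> i \<le> 2 * m then z ! (i - m - 1) else e i)"

lemma map_set_pt: "length z = m \<Longrightarrow> map (set_pt m e z) [m + 1..<2 * m + 1] = z"
  by (intro nth_equalityI) (auto simp: set_pt_def)

text \<open>Soundness and completeness of \<open>P\<close> as a supply of balls inside the fibres of
  \<open>W\<close>. Completeness grants a perturbation of the parameters by \<open>d\<close>,
  because \<open>P\<close> may miss lower-dimensional parts of the set of all such balls.\<close>

definition inner_balls :: "nat \<Rightarrow> nat \<Rightarrow> (nat \<Rightarrow> real) set \<Rightarrow> (nat \<Rightarrow> real) set \<Rightarrow> bool" where
  "inner_balls m K W P \<longleftrightarrow>
    (\<forall>e\<in>P. \<forall>z. length z = m \<longrightarrow> edist (map e [0..<m]) z < e m \<longrightarrow> set_pt m e z \<in> W) \<and>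
    (\<forall>e0 y d. length y = m \<longrightarrow> 0 < d \<longrightarrow>
      (\<forall>e. (\<forall>i. 2 * m < i \<and> i < K \<longrightarrow> \<bar>e i - e0 i\<bar> < d) \<longrightarrow>
        (\<forall>i<m. \<bar>e (m + 1 + i) - y ! i\<bar> < d) \<longrightarrow> e \<in> W) \<longrightarrow>
      (\<exists>e\<in>P. (\<forall>i<K. e i \<in> \<rat>) \<and> (\<forall>i. 2 * m < i \<and> i < K \<longrightarrow> \<bar>e i - e0 i\<bar> < d) \<and>
        edist (map e [0..<m]) y < e m))"

text \<open>The balls contained in a fibre form the semi-algebraic set \<open>D\<close>, and
  \<open>sa_interior\<close> yields \<open>P\<close>. A small box \<open>U\<close> of admissible
  centres, radii and parameters lies in \<open>D\<close>, so it meets \<open>P\<close>; being open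
  along lines, \<open>U \<inter> P\<close> has a rational point.\<close>

lemma ex_inner_balls:
  assumes W: "W \<in> sa F K" and K: "2 * m + 1 \<le> K"
  shows "\<exists>P\<in>sop F K. inner_balls m K W P"
proof -
  let ?blk = "[m + 1..<2 * m + 1]"
  let ?near = "{e. edist (map e [0..<m]) (map e ?blk) < e m}"
  \<comment> \<open>The universal quantifier over the points of the ball is written as a negated
    existential block.\<close>
  define D where "D = - {e. \<exists>e'\<in>?near \<inter> - W. \<forall>i. i \<notin> set ?blk \<longrightarrow> e' i = e i}"
  have "D \<in> sa F K" unfolding D_def
    using K by (intro sa.Compl sa_ex_block sa.Int sa_edist_less W) auto
  then obtain P where P: "P \<in> sop F K" "P \<subseteq> D"
    and dense: "\<forall>U. lopen U \<and> U \<noteq> {} \<and> U \<subseteq> D \<longrightarrow> U \<inter> P \<noteq> {}"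
    using sa_interior by blast
  have D: "set_pt m e z \<in> W" if "e \<in> D" "length z = m" "edist (map e [0..<m]) z < e m" for e z
  proof -
    have "map (set_pt m e z) [0..<m] = map e [0..<m]" by (simp add: set_pt_def)
    moreover have "map (set_pt m e z) ?blk = z"
      using that(2) by (rule map_set_pt)
    moreover have "set_pt m e z m = e m" by (simp add: set_pt_def)
    ultimately have "set_pt m e z \<in> ?near" using that(3) by (simp only: mem_Collect_eq)
    moreover have "\<forall>i. i \<notin> set ?blk \<longrightarrow> set_pt m e z i = e i" by (auto simp: set_pt_def)
    ultimately show ?thesis using that(1) unfolding D_def by blast
  qed
  have D': "e \<in> D" if "\<And>z. length z = m \<Longrightarrow> edist (map e [0..<m]) z < e m \<Longrightarrow> set_pt m e z \<in> W" for e
  proof (rule ccontr)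
    assume "e \<notin> D"
    then obtain e' where e': "e' \<in> ?near" "e' \<notin> W" "\<And>i. i \<notin> set ?blk \<Longrightarrow> e' i = e i"
      unfolding D_def by blast
    have eq: "map e' [0..<m] = map e [0..<m]" "e' m = e m" using e'(3) by auto
    have "edist (map e [0..<m]) (map e' ?blk) < e m" using e'(1) by (simp only: mem_Collect_eq eq)
    then have "set_pt m e (map e' ?blk) \<in> W" by (intro that) auto
    moreover have "set_pt m e (map e' ?blk) = e'" using e'(3) by (auto simp: set_pt_def fun_eq_iff)
    ultimately show False using e'(2) by simp
  qed
  show ?thesis
    unfolding inner_balls_def
  proof (intro bexI[OF _ P(1)] conjI ballI allI impI)
    show "set_pt m e z \<in> W" if "e \<in> P" "length z = m" "edist (map e [0..<m]) z < e m" for e z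
      using D that P(2) by blast
    fix e0 y and d :: real
    assume y: "length y = m" and "0 < d"
      and near_W: "\<forall>e. (\<forall>i. 2 * m < i \<and> i < K \<longrightarrow> \<bar>e i - e0 i\<bar> < d) \<longrightarrow>
        (\<forall>i<m. \<bar>e (m + 1 + i) - y ! i\<bar> < d) \<longrightarrow> e \<in> W"
    \<comment> \<open>The box is centred at the ball of radius \<open>d / 2\<close> around
      \<open>y\<close>. The tolerance \<open>b\<close> moves the centre by less than
      \<open>d / 4\<close> and leaves the radius between \<open>d / 4\<close> and
      \<open>3 * d / 4\<close>: the ball still contains \<open>y\<close>, and all its points are
      within \<open>d\<close> of \<open>y\<close>.\<close>
    define c where "c i = (if i < m then y ! i else if i = m then d / 2 else e0 i)" for i
    define b where "b = d / (4 * (real m + 1))"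
    have b: "0 < b" "b \<le> d / 4" "(real m + 1) * b = d / 4"
      using \<open>0 < d\<close> by (auto simp: b_def field_simps)
    define U where "U = {e. \<forall>i<K. \<bar>e i - c i\<bar> < b}"
    have edist_U: "edist (map e [0..<m]) y < d / 4" if e: "e \<in> U" for e
      unfolding b(3)[symmetric]
    proof (rule edist_coordinatewise)
      fix i assume i: "i < m"
      then have "\<bar>e i - c i\<bar> < b" using e K by (simp add: U_def)
      then show "\<bar>map e [0..<m] ! i - y ! i\<bar> < b" using i by (simp add: c_def)
    qed (use b in auto)
    have rad_U: "\<bar>e m - d / 2\<bar> < d / 4" if "e \<in> U" for e
    proof -
      have "\<bar>e m - c m\<bar> < b" using that K by (simp add: U_def)
      then show ?thesis using b by (simp add: c_def)
    qed
    have "lopen U" unfolding U_def by (rule lopen_box)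
    moreover have "c \<in> U" using b by (simp add: U_def)
    moreover have "U \<subseteq> D"
    proof
      fix e assume e: "e \<in> U"
      show "e \<in> D"
      proof (rule D', rule near_W[rule_format])
        fix z assume z: "length z = m" "edist (map e [0..<m]) z < e m"
        show "\<bar>set_pt m e z i - e0 i\<bar> < d" if "2 * m < i \<and> i < K" for i
        proof -
          have "\<bar>e i - c i\<bar> < b" using e that by (simp add: U_def)
          then show ?thesis using that b \<open>0 < d\<close> by (auto simp: set_pt_def c_def)
        qed
        show "\<bar>set_pt m e z (m + 1 + i) - y ! i\<bar> < d" if i: "i < m" for i
        proof -
          have "\<bar>e i - z ! i\<bar> \<le> edist (map e [0..<m]) z"
            using edist_coordinate[of i "map e [0..<m]" z] i by simp
          moreover have "\<bar>e i - y ! i\<bar> \<le> edist (map e [0..<m]) y"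
            using edist_coordinate[of i "map e [0..<m]" y] i by simp
          ultimately have "\<bar>z ! i - y ! i\<bar> < d" using z(2) edist_U[OF e] rad_U[OF e] by linarith
          then show ?thesis using i by (simp add: set_pt_def)
        qed
      qed
    qed
    ultimately obtain e1 where "e1 \<in> U \<inter> P" using dense by blast
    moreover have "lopen (U \<inter> P)" by (rule lopen_Int[OF \<open>lopen U\<close> lopen_sop[OF P(1)]])
    ultimately obtain e where e: "e \<in> U" "e \<in> P" "\<forall>i<K. e i \<in> \<rat>"
      using lopen_rational_point[of "U \<inter> P" e1 K] by blast
    have "\<bar>e i - e0 i\<bar> < d" if "2 * m < i" "i < K" for i
    proof -
      have "\<bar>e i - c i\<bar> < b" using e(1) that by (simp add: U_def)
      then show ?thesis using that b \<open>0 < d\<close> by (auto simp: c_def)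
    qed
    moreover have "edist (map e [0..<m]) y < e m" using edist_U[OF e(1)] rad_U[OF e(1)] by linarith
    ultimately show "\<exists>e\<in>P. (\<forall>i<K. e i \<in> \<rat>) \<and> (\<forall>i. 2 * m < i \<and> i < K \<longrightarrow> \<bar>e i - e0 i\<bar> < d) \<and>
        edist (map e [0..<m]) y < e m" using e by blast
  qed
qed

lemma inner_balls_sound:
  "inner_balls m K W P \<Longrightarrow> e \<in> P \<Longrightarrow> length z = m \<Longrightarrow> edist (map e [0..<m]) z < e m \<Longrightarrow> set_pt m e z \<in> W"
  by (simp add: inner_balls_def)

lemma inner_balls_complete:
  assumes "inner_balls m K W P" "length y = m" "0 < d"
    and "\<And>e. \<forall>i. 2 * m < i \<and> i < K \<longrightarrow> \<bar>e i - c i\<bar> < d \<Longrightarrow> \<forall>i<m. \<bar>e (m + 1 + i) - y ! i\<bar> < d \<Longrightarrow> e \<in> W"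
  obtains e where "e \<in> P" "\<forall>i<K. e i \<in> \<rat>" "\<forall>i. 2 * m < i \<and> i < K \<longrightarrow> \<bar>e i - c i\<bar> < d"
    "edist (map e [0..<m]) y < e m"
  using assms unfolding inner_balls_def by blast

section \<open>Codes of environments and of output balls\<close>

text \<open>A code yields a whole environment. Entries past the coded list are junk, which is
  harmless because a set in \<open>sop F K\<close> depends only on the coordinates below
  \<open>K\<close>.\<close>

definition env_dec :: "nat \<Rightarrow> nat \<Rightarrow> real" where
  "env_dec k i = of_rat (rat_dec (code_nth k i))"

lemma creal_env_dec: "rec1 g \<Longrightarrow> creal (\<lambda>p k. env_dec (g p k) i)"
  unfolding env_dec_def by (intro creal_rrat rrat_rat_dec rec1_code_nth)

lemma ex_env_dec:
  assumes "\<forall>i<K. e i \<in> \<rat>" obtains k where "\<And>i. i < K \<Longrightarrow> env_dec k i = e i"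
proof -
  define c where "c i = (SOME c. of_rat (rat_dec c) = e i)" for i
  have c: "of_rat (rat_dec (c i)) = e i" if "i < K" for i
    unfolding c_def by (rule someI_ex[OF ex_rat_dec]) (use assms that in simp)
  show ?thesis
    by (rule that[of "list_encode (map c [0..<K])"]) (simp add: env_dec_def code_nth_encode c)
qed

text \<open>The centre is encoded anew, as a list of exactly the length that
  \<open>ball_code\<close> checks.\<close>

definition out_ball :: "nat \<Rightarrow> nat \<Rightarrow> nat" where
  "out_ball m k = Suc (prod_encode (list_encode (map (code_nth k) [0..<m]), code_nth k m))"

lemma rec1_out_ball: "rec1 g \<Longrightarrow> rec1 (\<lambda>p k. out_ball m (g p k))"
  unfolding out_ball_def by (intro rec1_Suc rec1_pair rec1_list_encode rec1_code_nth)

lemma ball_code_Suc: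
  "ball_code n (Suc (prod_encode (a, b))) =
    (if length (list_decode a) = n
     then {z. length z = n \<and> edist (ratlist_dec a) z < of_rat (rat_dec b)} else {})"
proof -
  have "0 < q" if "edist x z < of_rat q" for x z q
  proof -
    have "0 < (of_rat q :: real)" using that edist_nonneg[of x z] by linarith
    then show ?thesis by simp
  qed
  then show ?thesis by (auto simp: ball_code_def ball_Rn_def Rn_def ratlist_dec_def)
qed

lemma ball_code_out_ball:
  "ball_code m (out_ball m k) = {z. length z = m \<and> edist (map (env_dec k) [0..<m]) z < env_dec k m}"
  by (simp add: out_ball_def ball_code_Suc ratlist_dec_def env_dec_def[abs_def] comp_def)

section \<open>Enumerating the domain and the images\<close>

lemma graph_append_iff:
  assumes "X \<subseteq> Rn n" "length x = n"
  shows "x @ y \<in> {x @ f x | x. x \<in> X} \<longleftrightarrow> x \<in> X \<and> y = f x"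
  using assms by (auto simp: Rn_def)

text \<open>The domain is the projection of the graph. Listing the balls given by \<open>P\<close>
  exhausts it, since every point of the open set \<open>X\<close> has a box inside
  \<open>X\<close>.\<close>

lemma re_open_semialg_dom:
  assumes X: "open_Rn n X" and m: "\<forall>x\<in>X. f x \<in> Rn m"
    and f: "semialg_fun computable_reals n m X f"
  shows "re_open n X"
proof -
  \<comment> \<open>Layout: centre, radius, the point \<open>?x\<close>, and its image
    \<open>?y\<close>. The last block is quantified away in \<open>W\<close>.\<close>
  define K where "K = 2 * n + 1 + m"
  let ?x = "[n + 1..<2 * n + 1]" and ?y = "[2 * n + 1..<K]"
  let ?G = "{x @ f x | x. x \<in> X}"
  have Rn: "X \<subseteq> Rn n" using X by (simp add: open_Rn_def)
  define W where "W = {e. \<exists>e'\<in>{e. map e (?x @ ?y) \<in> ?G}. \<forall>i. i \<notin> set ?y \<longrightarrow> e' i = e i}"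
  have "W \<in> sa computable_reals K"
    unfolding W_def
    by (intro sa_ex_block semialg_sa[OF f[unfolded semialg_fun_def]]) (auto simp: K_def)
  have W: "e \<in> W \<longleftrightarrow> map e ?x \<in> X" for e
  proof
    assume "e \<in> W"
    then obtain e' where e': "map e' ?x @ map e' ?y \<in> ?G" "\<forall>i. i \<notin> set ?y \<longrightarrow> e' i = e i"
      unfolding W_def by auto
    then have "map e' ?x \<in> X" by (subst (asm) graph_append_iff[OF Rn]) auto
    moreover have "map e' ?x = map e ?x" using e'(2) by auto
    ultimately show "map e ?x \<in> X" by (simp only:)
  next
    assume x: "map e ?x \<in> X"
    define e' where "e' i = (if i \<in> set ?y then f (map e ?x) ! (i - (2 * n + 1)) else e i)" for i
    have "length (f (map e ?x)) = m" using m x by (auto simp: Rn_def)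
    then have "map e' ?y = f (map e ?x)"
      by (intro nth_equalityI) (auto simp: e'_def K_def)
    moreover have "map e' ?x = map e ?x" by (auto simp: e'_def)
    ultimately have "map e' (?x @ ?y) \<in> ?G" using x by (simp only: map_append) blast
    then show "e \<in> W" unfolding W_def by (intro CollectI bexI[of _ e']) (auto simp: e'_def)
  qed
  obtain P where P: "P \<in> sop computable_reals K" and inner: "inner_balls n K W P"
    using ex_inner_balls[OF \<open>W \<in> _\<close>, of n] by (auto simp: K_def)
  have "semidec (\<lambda>p k. env_dec k \<in> P)"
    by (rule semidec_sop[OF P]) (rule creal_env_dec[OF rec1_id])
  from theta_name_semidec[OF this rec1_out_ball[OF rec1_id]]
  obtain e where e: "\<forall>p. \<exists>q. machine_out e p q \<and>
      theta_name n q (\<Union>k\<in>{k. env_dec k \<in> P}. ball_code n (out_ball n k))" by (rule exE)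
  have "(\<Union>k\<in>{k. env_dec k \<in> P}. ball_code n (out_ball n k)) = X"
  proof (intro equalityI subsetI)
    fix z assume "z \<in> (\<Union>k\<in>{k. env_dec k \<in> P}. ball_code n (out_ball n k))"
    then obtain k where "env_dec k \<in> P" and z: "length z = n"
      and "edist (map (env_dec k) [0..<n]) z < env_dec k n" by (auto simp: ball_code_out_ball)
    then have "set_pt n (env_dec k) z \<in> W" using inner_balls_sound[OF inner] by blast
    moreover have "map (set_pt n (env_dec k) z) ?x = z"
      using z by (rule map_set_pt)
    ultimately show "z \<in> X" unfolding W by simp
  next
    fix x assume x: "x \<in> X"
    then have len: "length x = n" using Rn by (auto simp: Rn_def)
    obtain r where r: "r > 0" "\<And>y. length y = n \<Longrightarrow> edist x y < r \<Longrightarrow> y \<in> X"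
      using X x unfolding open_Rn_def Rn_def by auto
    define d where "d = r / (real n + 1)"
    have d: "0 < d" "(real n + 1) * d = r" using r(1) by (auto simp: d_def field_simps)
    obtain e where e: "e \<in> P" "\<forall>i<K. e i \<in> \<rat>" "edist (map e [0..<n]) x < e n"
    \<comment> \<open>Membership in \<open>W\<close> ignores the coordinates beyond
      \<open>2 * n\<close>, so any target value, here 0, will do for them.\<close>
    proof (rule inner_balls_complete[OF inner len d(1), where c = "\<lambda>_. 0"])
      fix e :: "nat \<Rightarrow> real" assume "\<forall>i<n. \<bar>e (n + 1 + i) - x ! i\<bar> < d"
      then have "edist x (map e ?x) < (real n + 1) * d"
        by (intro edist_coordinatewise len d) (simp add: abs_minus_commute)
      then show "e \<in> W" unfolding W d by (intro r(2)) auto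
    qed
    obtain k where k: "\<And>i. i < K \<Longrightarrow> env_dec k i = e i" using ex_env_dec[OF e(2)] by blast
    have "env_dec k \<in> P" using sop_cong[OF P, of "env_dec k" e] k e(1) by simp
    moreover have "map (env_dec k) [0..<n] = map e [0..<n]" "env_dec k n = e n"
      by (auto simp: k K_def)
    then have "x \<in> ball_code n (out_ball n k)" using e(3) len by (simp add: ball_code_out_ball del: map_eq_conv)
    ultimately show "x \<in> (\<Union>k\<in>{k. env_dec k \<in> P}. ball_code n (out_ball n k))" by blast
  qed
  moreover obtain q where "machine_out e (\<lambda>_. 0) q"
      "theta_name n q (\<Union>k\<in>{k. env_dec k \<in> P}. ball_code n (out_ball n k))" using e by blast
  ultimately show ?thesis unfolding re_open_def computable_seq_def by auto
qed

text \<open>Openness of \<open>f\<close> enters through completeness: the image of a small ball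
  around \<open>x\<close> contains a neighbourhood of \<open>f x\<close>, so \<open>W\<close>
  contains a box around the chosen parameters and \<open>f x\<close>.\<close>

lemma effectively_open_semialg_fun:
  assumes X: "open_Rn n X" and m: "\<forall>x\<in>X. f x \<in> Rn m" and f_open: "open_map n m X f"
    and f: "semialg_fun computable_reals n m X f"
  shows "effectively_open n m X f"
proof -
  \<comment> \<open>Layout: centre and radius of the output ball, the point \<open>?z\<close> of it,
    centre \<open>?c\<close> and radius \<open>?r\<close> of a ball in the domain, and the preimage
    \<open>?x\<close>, which \<open>W\<close> quantifies away.\<close>
  define K where "K = 2 * m + 2 * n + 2"
  let ?z = "[m + 1..<2 * m + 1]" and ?c = "[2 * m + 1..<2 * m + 1 + n]" and ?r = "2 * m + 1 + n"
    and ?x = "[2 * m + n + 2..<K]"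
  let ?G = "{x @ f x | x. x \<in> X}"
  have Rn: "X \<subseteq> Rn n" using X by (simp add: open_Rn_def)
  define W where "W = {e. \<exists>e'\<in>{e. map e (?x @ ?z) \<in> ?G} \<inter> {e. edist (map e ?c) (map e ?x) < e ?r}.
      \<forall>i. i \<notin> set ?x \<longrightarrow> e' i = e i}"
  have "W \<in> sa computable_reals K"
    unfolding W_def
    by (intro sa_ex_block sa.Int sa_edist_less semialg_sa[OF f[unfolded semialg_fun_def]])
      (auto simp: K_def)
  have W: "e \<in> W \<longleftrightarrow> (\<exists>x\<in>X. map e ?z = f x \<and> edist (map e ?c) x < e ?r)" for e
  proof
    assume "e \<in> W"
    then obtain e' where mem: "e' \<in> {e. map e (?x @ ?z) \<in> ?G} \<inter> {e. edist (map e ?c) (map e ?x) < e ?r}"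
      and e'_e: "\<forall>i. i \<notin> set ?x \<longrightarrow> e' i = e i"
      unfolding W_def by blast
    from mem have e': "map e' ?x @ map e' ?z \<in> ?G" "edist (map e' ?c) (map e' ?x) < e' ?r"
      by (simp_all only: Int_iff mem_Collect_eq map_append)
    have "map e' ?x \<in> X \<and> map e' ?z = f (map e' ?x)"
      using e'(1) by (subst (asm) graph_append_iff[OF Rn]) (auto simp: K_def)
    moreover have eq: "map e' ?z = map e ?z" "map e' ?c = map e ?c" "e' ?r = e ?r"
      using e'_e by (auto simp: K_def)
    ultimately show "\<exists>x\<in>X. map e ?z = f x \<and> edist (map e ?c) x < e ?r"
      using e'(2) by (intro bexI[of _ "map e' ?x"]) (simp_all only: eq)
  next
    assume "\<exists>x\<in>X. map e ?z = f x \<and> edist (map e ?c) x < e ?r"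
    then obtain x where x: "x \<in> X" "map e ?z = f x" "edist (map e ?c) x < e ?r" by blast
    define e' where "e' i = (if i \<in> set ?x then x ! (i - (2 * m + n + 2)) else e i)" for i
    have "length x = n" using x(1) Rn by (auto simp: Rn_def)
    then have ex: "map e' ?x = x"
      by (intro nth_equalityI) (auto simp: e'_def K_def)
    have eq: "map e' ?z = map e ?z" "map e' ?c = map e ?c" "e' ?r = e ?r"
      by (auto simp: e'_def K_def)
    have "map e' (?x @ ?z) \<in> ?G" unfolding map_append ex eq x(2) using x(1) by blast
    moreover have "edist (map e' ?c) (map e' ?x) < e' ?r" unfolding ex eq by (rule x(3))
    ultimately show "e \<in> W" unfolding W_def by (intro CollectI bexI[of _ e']) (auto simp: e'_def)
  qed
  obtain P where P: "P \<in> sop computable_reals K" and inner: "inner_balls m K W P"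
    using ex_inner_balls[OF \<open>W \<in> _\<close>, of m] by (auto simp: K_def)
  let ?w = "\<lambda>k. env_dec (snd (prod_decode k))"
  \<comment> \<open>An index pairs a position in the name of \<open>U\<close> with a code of an
    environment. Subtracting 1 strips the \<open>Suc\<close> of a ball code; the code 0 of the empty
    set is rejected in \<open>Q\<close>.\<close>
  let ?b = "\<lambda>p k. p (fst (prod_decode k)) - 1"
  let ?a = "\<lambda>p k. fst (prod_decode (?b p k))"
  let ?R = "\<lambda>p k. of_rat (rat_dec (snd (prod_decode (?b p k)))) :: real"
  \<comment> \<open>The last two conjuncts say that the distance of the centres plus
    \<open>?r\<close> stays below the radius of the named ball, with squares so that
    \<open>semidec_pos\<close> applies; \<open>Q_iff\<close> restores the geometric form.\<close>
  define Q where "Q p k \<longleftrightarrow> p (fst (prod_decode k)) \<noteq> 0 \<and> length (list_decode (?a p k)) = n \<and> ?w k \<in> P \<and>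
      0 < ?R p k - ?w k ?r \<and> 0 < (?R p k - ?w k ?r)\<^sup>2 - (\<Sum>i<n. (env_dec (?a p k) i - ?w k (?c ! i))\<^sup>2)" for p k
  have Q_iff: "Q p k \<longleftrightarrow> p (fst (prod_decode k)) \<noteq> 0 \<and> length (list_decode (?a p k)) = n \<and> ?w k \<in> P \<and>
      edist (ratlist_dec (?a p k)) (map (?w k) ?c) < ?R p k - ?w k ?r" for p k
  proof -
    have "edist (ratlist_dec (?a p k)) (map (?w k) ?c) < ?R p k - ?w k ?r \<longleftrightarrow> 0 < ?R p k - ?w k ?r \<and>
       0 < (?R p k - ?w k ?r)\<^sup>2 - (\<Sum>i<n. (env_dec (?a p k) i - ?w k (?c ! i))\<^sup>2)"
      if "length (list_decode (?a p k)) = n"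
    proof -
      have "(\<Sum>i<n. (env_dec (?a p k) i - ?w k (?c ! i))\<^sup>2)
          = (\<Sum>i<length (ratlist_dec (?a p k)). (ratlist_dec (?a p k) ! i - map (?w k) ?c ! i)\<^sup>2)"
        using that by (auto simp: ratlist_dec_def env_dec_def code_nth_decode)
      then show ?thesis by (simp add: edist_less_iff)
    qed
    then show ?thesis unfolding Q_def by blast
  qed
  have a: "rec1 ?a" "rec1 (\<lambda>p k. snd (prod_decode (?b p k)))" "rec1 (\<lambda>p k. p (fst (prod_decode k)))"
    by (intro rec1_fst rec1_snd rec1_diff rec1_oracle rec1_const rec1_id)+
  have w: "creal (\<lambda>p k. ?w k i)" for i by (intro creal_env_dec rec1_snd rec1_id)
  have diff: "creal (\<lambda>p k. g p k - h p k)" if "creal g" "creal h" for g h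
    using creal_add[OF that(1) creal_mult[OF creal_rrat[OF rrat_minus[OF rrat_of_nat[OF rec1_const[of 1]]]] that(2)]]
    by simp
  have power2: "creal (\<lambda>p k. (g p k)\<^sup>2)" if "creal g" for g
    unfolding power2_eq_square by (intro creal_mult that)
  have sum: "creal (\<lambda>p k. \<Sum>i<l. g i p k)" if "\<And>i. creal (g i)" for g and l :: nat
    using creal_rrat[OF rrat_of_nat[OF rec1_const[of 0]]] by (induction l) (auto intro: creal_add that)
  have R: "creal (\<lambda>p k. ?R p k - ?w k ?r)"
    by (intro diff w creal_rrat rrat_rat_dec a)
  have "semidec Q"
    unfolding Q_def length_list_decode_eq
    by (intro semidec_conj semidec_ball_less semidec_neq_0 semidec_eq_0 semidec_pos
        semidec_sop[OF P] rec1_code_tl diff power2 sum R a w creal_env_dec)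
  from theta_name_semidec[OF this rec1_out_ball[OF rec1_snd[OF rec1_id]]]
  obtain e where e: "\<forall>p. \<exists>q. machine_out e p q \<and>
      theta_name m q (\<Union>k\<in>{k. Q p k}. ball_code m (out_ball m (snd (prod_decode k))))" by (rule exE)
  have image: "(\<Union>k\<in>{k. Q p k}. ball_code m (out_ball m (snd (prod_decode k)))) = f ` U"
    if U: "open_Rn n U" "U \<subseteq> X" and name: "theta_name n p U" for p U
  proof (intro equalityI subsetI)
    fix z assume "z \<in> (\<Union>k\<in>{k. Q p k}. ball_code m (out_ball m (snd (prod_decode k))))"
    then obtain k where k: "Q p k" and z: "length z = m"
      and "edist (map (?w k) [0..<m]) z < ?w k m" by (auto simp: ball_code_out_ball)
    then have "set_pt m (?w k) z \<in> W" by (intro inner_balls_sound[OF inner]) (auto simp: Q_def)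
    moreover have "map (set_pt m (?w k) z) ?z = z" using z by (rule map_set_pt)
    moreover have "map (set_pt m (?w k) z) ?c = map (?w k) ?c" "set_pt m (?w k) z ?r = ?w k ?r"
      by (auto simp: set_pt_def)
    ultimately obtain x where x: "x \<in> X" "z = f x" "edist (map (?w k) ?c) x < ?w k ?r"
      unfolding W by (auto simp del: map_eq_conv)
    have len: "length x = n" "length (ratlist_dec (?a p k)) = n"
      using x(1) Rn k by (auto simp: Rn_def Q_def ratlist_dec_def)
    have less: "edist (ratlist_dec (?a p k)) x < ?R p k"
      using edist_triangle[OF len(2) _ len(1), of "map (?w k) ?c"] x(3) k by (auto simp: Q_iff)
    have enc: "p (fst (prod_decode k)) = Suc (prod_encode (?a p k, snd (prod_decode (?b p k))))"
      using k by (simp add: Q_def)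
    have "length (list_decode (?a p k)) = n" using k by (simp add: Q_def)
    then have "x \<in> ball_code n (p (fst (prod_decode k)))"
      using len(1) less by (subst enc, subst ball_code_Suc) simp
    then have "x \<in> U" using name by (auto simp: theta_name_def)
    then show "z \<in> f ` U" using x(2) by blast
  next
    fix z assume "z \<in> f ` U"
    then obtain x where x: "x \<in> U" "z = f x" by blast
    have len: "length x = n" "length z = m" using x U m Rn by (auto simp: Rn_def)
    obtain j where j: "x \<in> ball_code n (p j)" using name x(1) by (auto simp: theta_name_def)
    then obtain b where b: "p j = Suc b" by (cases "p j") (auto simp: ball_code_def)
    define ctr where "ctr = fst (prod_decode b)"
    define R where "R = (of_rat (rat_dec (snd (prod_decode b))) :: real)"
    have ball: "length (list_decode ctr) = n"
      "ball_code n (p j) = {y. length y = n \<and> edist (ratlist_dec ctr) y < R}"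
      using j ball_code_Suc[of n ctr "snd (prod_decode b)"] by (auto simp: b ctr_def R_def split: if_splits)
    have len_ctr: "length (ratlist_dec ctr) = n" using ball(1) by (simp add: ratlist_dec_def)
    \<comment> \<open>The slack of \<open>x\<close> inside the named ball; all tolerances below are
      fractions of it.\<close>
    define g where "g = R - edist (ratlist_dec ctr) x"
    have g: "0 < g" using j ball by (simp add: g_def)
    have sub: "ball_Rn n x (g / 8) \<subseteq> X"
    proof
      fix y assume "y \<in> ball_Rn n x (g / 8)"
      then have "y \<in> ball_code n (p j)"
        unfolding ball(2) using edist_triangle[OF len_ctr len(1), of y] g
        by (auto simp: ball_Rn_def Rn_def g_def)
      then show "y \<in> X" using name U(2) by (auto simp: theta_name_def)
    qed
    have "open_Rn m (f ` ball_Rn n x (g / 8))"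
      using f_open open_ball_Rn[OF len(1)] sub unfolding open_map_def by blast
    moreover have "x \<in> ball_Rn n x (g / 8)" using g len by (simp add: ball_Rn_def Rn_def edist_def)
    ultimately obtain h where h: "0 < h"
      "\<And>y. length y = m \<Longrightarrow> edist z y < h \<Longrightarrow> y \<in> f ` ball_Rn n x (g / 8)"
      unfolding open_Rn_def Rn_def x(2) by auto
    \<comment> \<open>Coordinatewise closeness within \<open>d\<close> keeps points within
      \<open>h\<close> of \<open>z\<close>, and centres within \<open>g / 8\<close> of
      \<open>x\<close>.\<close>
    define d where "d = min (h / (real m + 1)) (g / (8 * (real n + 1)))"
    have d: "0 < d" using g h by (simp add: d_def)
    have dm: "(real m + 1) * d \<le> h"
    proof -
      have "d \<le> h / (real m + 1)" by (simp add: d_def)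
      then show ?thesis by (simp add: field_simps)
    qed
    have dn: "(real n + 1) * d \<le> g / 8"
    proof -
      have "d \<le> g / (8 * (real n + 1))" by (simp add: d_def)
      then show ?thesis by (simp add: field_simps)
    qed
    have d8: "d \<le> g / 8"
    proof -
      have "1 * d \<le> (real n + 1) * d" using d by (intro mult_right_mono) auto
      then show ?thesis using dn by simp
    qed
    \<comment> \<open>Target parameters: centre \<open>x\<close> and radius \<open>g / 2\<close>.
      After perturbation the radius lies between \<open>3 * g / 8\<close> and
      \<open>5 * g / 8\<close> and the centre within \<open>g / 8\<close> of \<open>x\<close>. So
      the ball contains the \<open>g / 8\<close>-ball around \<open>x\<close> and still fits into
      the named ball.\<close>
    define e0 where "e0 i = (if i < ?r then x ! (i - (2 * m + 1)) else g / 2)" for i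
    have near: "edist x (map e ?c) < g / 8" "\<bar>e ?r - g / 2\<bar> < g / 8"
      if e: "\<forall>i. 2 * m < i \<and> i < K \<longrightarrow> \<bar>e i - e0 i\<bar> < d" for e :: "nat \<Rightarrow> real"
    proof -
      have "edist x (map e ?c) < (real n + 1) * d"
      proof (rule edist_coordinatewise[OF len(1) d])
        fix i assume i: "i < n"
        then have "\<bar>e (2 * m + 1 + i) - e0 (2 * m + 1 + i)\<bar> < d" using e by (simp add: K_def)
        then show "\<bar>x ! i - map e ?c ! i\<bar> < d" using i by (simp add: e0_def abs_minus_commute)
      qed
      then show "edist x (map e ?c) < g / 8" using dn by linarith
      have "\<bar>e ?r - e0 ?r\<bar> < d" using e by (simp add: K_def)
      then show "\<bar>e ?r - g / 2\<bar> < g / 8" using d8 by (simp add: e0_def)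
    qed
    obtain e where e: "e \<in> P" "\<forall>i<K. e i \<in> \<rat>" "\<forall>i. 2 * m < i \<and> i < K \<longrightarrow> \<bar>e i - e0 i\<bar> < d"
      "edist (map e [0..<m]) z < e m"
    proof (rule inner_balls_complete[OF inner len(2) d, where c = e0])
      fix e :: "nat \<Rightarrow> real"
      assume e: "\<forall>i. 2 * m < i \<and> i < K \<longrightarrow> \<bar>e i - e0 i\<bar> < d"
        and ez: "\<forall>i<m. \<bar>e (m + 1 + i) - z ! i\<bar> < d"
      have "edist z (map e ?z) < (real m + 1) * d"
        using ez by (intro edist_coordinatewise len d) (simp add: abs_minus_commute)
      then have "map e ?z \<in> f ` ball_Rn n x (g / 8)" using dm by (intro h(2)) auto
      then obtain y where y: "map e ?z = f y" "y \<in> ball_Rn n x (g / 8)" by blast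
      then have "y \<in> X" "length y = n" "edist x y < g / 8" using sub by (auto simp: ball_Rn_def Rn_def)
      moreover have "edist (map e ?c) y \<le> edist (map e ?c) x + edist x y"
        by (rule edist_triangle[where n = n]) (use len \<open>length y = n\<close> in auto)
      moreover have "edist (map e ?c) x = edist x (map e ?c)" using len by (intro edist_commute) simp
      ultimately have "edist (map e ?c) y < e ?r" using near[OF e] by linarith
      then show "e \<in> W" unfolding W using y(1) \<open>y \<in> X\<close> by blast
    qed
    obtain l where l: "\<And>i. i < K \<Longrightarrow> env_dec l i = e i" using ex_env_dec[OF e(2)] by blast
    let ?k = "prod_encode (j, l)"
    have "env_dec l \<in> P" using sop_cong[OF P, of "env_dec l" e] l e(1) by simp
    have eq: "map (env_dec l) [0..<m] = map e [0..<m]" "env_dec l m = e m"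
      "map (env_dec l) ?c = map e ?c" "env_dec l ?r = e ?r" by (auto simp: l K_def)
    have "edist (ratlist_dec ctr) (map e ?c) \<le> edist (ratlist_dec ctr) x + edist x (map e ?c)"
      by (rule edist_triangle[where n = n]) (use len len_ctr in auto)
    moreover have "R = g + edist (ratlist_dec ctr) x" by (simp add: g_def)
    ultimately have "edist (ratlist_dec ctr) (map e ?c) < R - e ?r"
      using near[OF e(3)] g by linarith
    then have "Q p ?k"
      unfolding Q_iff using \<open>env_dec l \<in> P\<close> ball(1) eq(3,4)
      by (simp add: b ctr_def R_def del: map_eq_conv)
    moreover have "z \<in> ball_code m (out_ball m (snd (prod_decode ?k)))"
      using e(4) len eq(1,2) by (simp add: ball_code_out_ball del: map_eq_conv)
    ultimately show "z \<in> (\<Union>k\<in>{k. Q p k}. ball_code m (out_ball m (snd (prod_decode k))))" by blast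
  qed
  show ?thesis
    unfolding effectively_open_def
  proof (intro exI[of _ e] allI impI)
    fix U p assume U: "open_Rn n U \<and> U \<subseteq> X" "theta_name n p U"
    obtain q where "machine_out e p q"
      "theta_name m q (\<Union>k\<in>{k. Q p k}. ball_code m (out_ball m (snd (prod_decode k))))"
      using e by blast
    then show "\<exists>q. theta_name m q (f ` U) \<and> machine_out e p q"
      using image[of U p] U by auto
  qed
qed

theorem theorem5:
  fixes n m :: nat and X :: "real list set" and f :: "real list \<Rightarrow> real list"
  assumes "open_Rn n X"
    and "\<forall>x\<in>X. f x \<in> Rn m"
    and "computable_fun n m X f"
    and "open_map n m X f"
    and "semialg_fun computable_reals n m X f"
  shows "re_open n X \<and> effectively_open n m X f"
  using re_open_semialg_dom effectively_open_semialg_fun assms by blast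

end
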